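(* Let $G$ be a connected Lie group whose Lie algebra $\mathfrak g$ is a noncompact real simple Lie algebra (possibly a complex simple Lie algebra regarded as real), let $\theta$ be a Cartan involution with Cartan decomposition $\mathfrak g=\mathfrak k\oplus\mathfrak p$, and let $\mathfrak h_0=\mathfrak t\oplus\mathfrak a$ be a maximally noncompact $\theta$-stable Cartan subalgebra with $\mathfrak a=\mathfrak h_0\cap\mathfrak p$. Let $\Omega$ be a regular orbit in $\mathfrak g$, say of type $\mathbf F=\{\alpha_1,\dots,\alpha_j\}$ ($j\ge0$), let $X\in\Omega$ have stabilizer algebra $\mathfrak g_X=\mathfrak h_{\mathbf F}$, and let $\mathfrak n_j:=\bigoplus_{\mu\in\Sigma_j}\mathfrak g_\mu$ be the nilpotent subalgebra associated to $\mathbf F$. Then the left-invariant isotropic foliation $\mathcal N_j$ of $\Omega$ with $(\mathcal N_j)_X=\mathfrak n_j$ is a $\dim\mathfrak n_j$-ruling; that is, its leaves are $\dim\mathfrak n_j$-dimensional affine subspaces of $\mathfrak g$.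
   Context: $B$ is the Killing form. $X\in\mathfrak g$ is regular if the coefficient of $\lambda^r$ in $\det(\lambda\mathbf 1-ad_X)$ is nonzero, $r$ being the rank of $\mathfrak g$; $\mathfrak g_X=\{Y\in\mathfrak g:[X,Y]=0\}$. A regular orbit is the adjoint orbit $Ad_GX$ of a regular element. A $\theta$-stable Cartan subalgebra $\mathfrak h$ is maximally noncompact if $\dim(\mathfrak h\cap\mathfrak p)$ is as large as possible; $\mathfrak t=\mathfrak h_0\cap\mathfrak k$. $\Delta=\Delta(\mathfrak g^{\mathbb C},\mathfrak h_0^{\mathbb C})$ is the root system, $\Sigma=\Sigma(\mathfrak g,\mathfrak a)$ is the restricted root system, and $\mathfrak g_\mu$ ($\mu\in\Sigma$) are the restricted root spaces; positive systems $\Delta^+$ and $\Sigma^+$ are chosen compatibly, so that positive roots with nonzero restriction to $\mathfrak a$ restrict to positive restricted roots. A root is real if it takes real values on $\mathfrak h_0$, equivalently if it vanishes on $\mathfrak t$. A real admissible root system is a (possibly empty) set $\mathbf F=\{\alpha_1,\dots,\alpha_j\}$ of distinct positive real roots with $\alpha_i\pm\alpha_k\notin\Delta$ for all $i,k$. For a real root $\alpha$, $E_\alpha$ is a vector in the intersection of the $\alpha$-root space with $\mathfrak g$, normalized by $B(E_\alpha,\theta E_\alpha)=-2/|\alpha|^2$. The Cartan subalgebra associated to $\mathbf F$ is $$\mathfrak h_{\mathbf F}=\bigcap_{m=1}^j\ker(\alpha_m|_{\mathfrak h_0})\oplus\bigoplus_{m=1}^j\mathbb R(E_{\alpha_m}+\theta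 E_{\alpha_m}),\qquad \mathfrak h_\emptyset=\mathfrak h_0.$$ $\Omega$ is of type $\mathbf F$ if the stabilizer algebras of its points are conjugate to $\mathfrak h_{\mathbf F}$; $\Omega$ is maximally noncompact if $\mathbf F=\emptyset$. (If $\mathfrak g$ is complex, only $\mathbf F=\emptyset$ occurs.) Let $\beta_m=\alpha_m|_{\mathfrak a}\in\Sigma^+$ and $\Sigma_0=\Sigma^+$; thus for $\mathbf F=\emptyset$ the subalgebra is $\mathfrak n_0=\mathfrak n=\bigoplus_{\mu\in\Sigma^+}\mathfrak g_\mu$, the nilpotent part of the Iwasawa decomposition. For $n=1,\dots,j$, $\Sigma_n$ is the largest subset of $\Sigma_{n-1}$ such that: (1) for each $m=1,\dots,n$, if $\mu\in\Sigma_n$ and $\mu\pm\beta_m\in\Sigma$, then $\mu\pm\beta_m\in\Sigma_n$; (2) for each $m=1,\dots,n$, $\pm\beta_m\notin(\Sigma_n+\Sigma_n)\cap\Sigma$; (3) $(\Sigma_n+\Sigma_n)\cap\Sigma\subset\Sigma_n$. $T_X\Omega=\{[U,X]:U\in\mathfrak g\}$ is identified with $\mathfrak g/\mathfrak g_X$ via $U\mapsto[U,X]$, and $\mathfrak n_j\subset\mathfrak g$ is regarded as a subspace of $T_X\Omega$ in this way. The Kirillov form $\omega$ is the $G$-invariant symplectic form on $\Omega$ with $\omega_X(U,V)=B(X,[U,V])$ under this identification. A foliation of $\Omega$ is left-invariant if its tangent distribution is invariant under the action of $G$ by $Ad$, and isotropic if $\omega$ vanishes on its tangent spaces. A foliation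 of a submanifold $M\subset\mathbb R^N$ is an $n$-ruling if its leaves are $n$-dimensional affine subspaces.
   Formalization: The conditions defining Σ_n carry the extra requirement that no β_m (m = 1,…,n) belongs to Σ_n; without it the foliation need not exist (𝔤 = sl(2,R), F = {α}: the stabilizer SO(2) preserves no line in the tangent plane). *)

theory Defs
  imports
    "HOL-Analysis.Analysis"
    "HOL-Algebra.Group"
    "HOL-Library.Function_Algebras"
    "HOL-Computational_Algebra.Polynomial"
begin

section \<open>Smooth maps on open sets\<close>

primrec times_differentiable_on ::
    "nat \<Rightarrow> 'a::real_normed_vector set \<Rightarrow> ('a \<Rightarrow> 'b::real_normed_vector) \<Rightarrow> bool" where
  "times_differentiable_on 0 S f \<longleftrightarrow> continuous_on S f"
| "times_differentiable_on (Suc n) S f \<longleftrightarrow>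
     (\<forall>x\<in>S. f differentiable (at x)) \<and>
     (\<forall>v. times_differentiable_on n S (\<lambda>x. frechet_derivative f (at x) v))"

text \<open>Only used for open \<open>S\<close>.\<close>

definition smooth_on :: "'a::real_normed_vector set \<Rightarrow> ('a \<Rightarrow> 'b::real_normed_vector) \<Rightarrow> bool" where
  "smooth_on S f \<longleftrightarrow> (\<forall>n. times_differentiable_on n S f)"


section \<open>Lie groups\<close>

type_synonym ('g, 'n) gchart = "'g set \<times> ('g \<Rightarrow> real^'n)"

definition smooth_atlas :: "'g topology \<Rightarrow> ('g, 'n::finite) gchart set \<Rightarrow> bool" where
  "smooth_atlas T A \<longleftrightarrow>
     (\<forall>(U, \<phi>)\<in>A. openin T U \<and> open (\<phi> ` U) \<and>
        homeomorphic_map (subtopology T U) (top_of_set (\<phi> ` U)) \<phi>) \<and>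
     (\<Union>(U, \<phi>)\<in>A. U) = topspace T \<and>
     (\<forall>(U, \<phi>)\<in>A. \<forall>(V, \<psi>)\<in>A. smooth_on (\<phi> ` (U \<inter> V)) (\<lambda>x. \<psi> (inv_into U \<phi> x)))"

definition lie_group ::
    "('g, 'b) monoid_scheme \<Rightarrow> 'g topology \<Rightarrow> ('g, 'n::finite) gchart set \<Rightarrow> bool" where
  "lie_group G T A \<longleftrightarrow>
     group G \<and> topspace T = carrier G \<and> Hausdorff_space T \<and> second_countable T \<and>
     smooth_atlas T A \<and>
     continuous_map (prod_topology T T) T (\<lambda>(g, h). g \<otimes>\<^bsub>G\<^esub> h) \<and>
     continuous_map T T (\<lambda>g. inv\<^bsub>G\<^esub> g) \<and>
     (\<forall>(U, \<phi>)\<in>A. \<forall>(V, \<psi>)\<in>A. \<forall>(W, \<eta>)\<in>A.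
        smooth_on {(x, y). x \<in> \<phi> ` U \<and> y \<in> \<psi> ` V \<and> inv_into U \<phi> x \<otimes>\<^bsub>G\<^esub> inv_into V \<psi> y \<in> W}
          (\<lambda>(x, y). \<eta> (inv_into U \<phi> x \<otimes>\<^bsub>G\<^esub> inv_into V \<psi> y))) \<and>
     (\<forall>(U, \<phi>)\<in>A. \<forall>(V, \<psi>)\<in>A.
        smooth_on {x. x \<in> \<phi> ` U \<and> inv\<^bsub>G\<^esub> (inv_into U \<phi> x) \<in> V}
          (\<lambda>x. \<psi> (inv\<^bsub>G\<^esub> (inv_into U \<phi> x))))"

text \<open>
  A chart \<open>c = (U, \<phi>)\<close> around the identity identifies the tangent space at the identity
  with \<open>real^'n\<close>. In this identification \<open>Ad G c g\<close> is the differential at the identity of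
  conjugation by \<open>g\<close>, and the Lie bracket is \<open>[u, v] = ad u v\<close>, where \<open>ad\<close> is the
  differential of \<open>Ad\<close> at the identity. Since the atlas may contain \<open>\<phi>\<close> composed with any
  linear automorphism, every identification of the Lie algebra with \<open>real^'n\<close> is covered.
\<close>

definition Ad ::
    "('g, 'b) monoid_scheme \<Rightarrow> ('g, 'n::finite) gchart \<Rightarrow> 'g \<Rightarrow> real^'n \<Rightarrow> real^'n" where
  "Ad G c g = (case c of (U, \<phi>) \<Rightarrow>
     frechet_derivative (\<lambda>x. \<phi> (g \<otimes>\<^bsub>G\<^esub> inv_into U \<phi> x \<otimes>\<^bsub>G\<^esub> inv\<^bsub>G\<^esub> g)) (at (\<phi> \<one>\<^bsub>G\<^esub>)))"

definition lie_bracket ::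
    "('g, 'b) monoid_scheme \<Rightarrow> ('g, 'n::finite) gchart \<Rightarrow> real^'n \<Rightarrow> real^'n \<Rightarrow> real^'n" where
  "lie_bracket G c u v = (case c of (U, \<phi>) \<Rightarrow>
     frechet_derivative (\<lambda>x. Ad G c (inv_into U \<phi> x) v) (at (\<phi> \<one>\<^bsub>G\<^esub>)) u)"

definition adjoint_orbit ::
    "('g, 'b) monoid_scheme \<Rightarrow> ('g, 'n::finite) gchart \<Rightarrow> real^'n \<Rightarrow> (real^'n) set" where
  "adjoint_orbit G c X = {Ad G c g X | g. g \<in> carrier G}"


section \<open>Real Lie algebras\<close>

text \<open>
  A real Lie algebra of dimension \<open>n\<close> is \<open>real^'n\<close> with a bracket \<open>br\<close>;
  thus \<open>br X\<close> is the operator \<open>ad X\<close>.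
\<close>

type_synonym 'n bracket = "real^'n \<Rightarrow> real^'n \<Rightarrow> real^'n"

definition lie_algebra :: "'n::finite bracket \<Rightarrow> bool" where
  "lie_algebra br \<longleftrightarrow> bilinear br \<and> (\<forall>x. br x x = 0) \<and>
     (\<forall>x y z. br x (br y z) + br y (br z x) + br z (br x y) = 0)"

definition lie_ideal :: "'n::finite bracket \<Rightarrow> (real^'n) set \<Rightarrow> bool" where
  "lie_ideal br I \<longleftrightarrow> subspace I \<and> (\<forall>x. \<forall>y\<in>I. br x y \<in> I)"

definition simple_lie_algebra :: "'n::finite bracket \<Rightarrow> bool" where
  "simple_lie_algebra br \<longleftrightarrow> lie_algebra br \<and> (\<exists>x y. br x y \<noteq> 0) \<and>
     (\<forall>I. lie_ideal br I \<longrightarrow> I = {0} \<or> I = UNIV)"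

definition killing :: "'n::finite bracket \<Rightarrow> real^'n \<Rightarrow> real^'n \<Rightarrow> real" where
  "killing br x y = trace (matrix (br x \<circ> br y))"

text \<open>A semisimple real Lie algebra is compact iff its Killing form is negative definite.\<close>

definition noncompact_lie_algebra :: "'n::finite bracket \<Rightarrow> bool" where
  "noncompact_lie_algebra br \<longleftrightarrow> \<not> (\<forall>x. x \<noteq> 0 \<longrightarrow> killing br x x < 0)"

definition ad_charpoly :: "'n::finite bracket \<Rightarrow> real^'n \<Rightarrow> real poly" where
  "ad_charpoly br X = det (mat [:0, 1:] - (\<chi> i k. [: matrix (br X) $ i $ k :]))"

definition lie_rank :: "'n::finite bracket \<Rightarrow> nat" where
  "lie_rank br = (LEAST r. \<exists>X. coeff (ad_charpoly br X) r \<noteq> 0)"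

definition regular_element :: "'n::finite bracket \<Rightarrow> real^'n \<Rightarrow> bool" where
  "regular_element br X \<longleftrightarrow> coeff (ad_charpoly br X) (lie_rank br) \<noteq> 0"

definition stabilizer_algebra :: "'n::finite bracket \<Rightarrow> real^'n \<Rightarrow> (real^'n) set" where
  "stabilizer_algebra br X = {Y. br X Y = 0}"

definition cartan_involution :: "'n::finite bracket \<Rightarrow> (real^'n \<Rightarrow> real^'n) \<Rightarrow> bool" where
  "cartan_involution br \<theta> \<longleftrightarrow> linear \<theta> \<and> (\<forall>x y. \<theta> (br x y) = br (\<theta> x) (\<theta> y)) \<and>
     (\<forall>x. \<theta> (\<theta> x) = x) \<and> (\<forall>x. x \<noteq> 0 \<longrightarrow> - killing br x (\<theta> x) > 0)"

definition p_part :: "(real^'n::finite \<Rightarrow> real^'n) \<Rightarrow> (real^'n) set" where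
  "p_part \<theta> = {x. \<theta> x = - x}"

primrec lower_central :: "'n::finite bracket \<Rightarrow> (real^'n) set \<Rightarrow> nat \<Rightarrow> (real^'n) set" where
  "lower_central br h 0 = h"
| "lower_central br h (Suc n) = span {br x y | x y. x \<in> h \<and> y \<in> lower_central br h n}"

definition cartan_subalgebra :: "'n::finite bracket \<Rightarrow> (real^'n) set \<Rightarrow> bool" where
  "cartan_subalgebra br h \<longleftrightarrow> subspace h \<and> (\<forall>x\<in>h. \<forall>y\<in>h. br x y \<in> h) \<and>
     (\<exists>n. lower_central br h n = {0}) \<and>
     {x. \<forall>y\<in>h. br x y \<in> h} = h"

definition stable_cartan :: "'n::finite bracket \<Rightarrow> (real^'n \<Rightarrow> real^'n) \<Rightarrow> (real^'n) set \<Rightarrow> bool" where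
  "stable_cartan br \<theta> h \<longleftrightarrow> cartan_subalgebra br h \<and> \<theta> ` h = h"

definition maximally_noncompact_cartan ::
    "'n::finite bracket \<Rightarrow> (real^'n \<Rightarrow> real^'n) \<Rightarrow> (real^'n) set \<Rightarrow> bool" where
  "maximally_noncompact_cartan br \<theta> h \<longleftrightarrow> stable_cartan br \<theta> h \<and>
     (\<forall>h'. stable_cartan br \<theta> h' \<longrightarrow> dim (h' \<inter> p_part \<theta>) \<le> dim (h \<inter> p_part \<theta>))"


section \<open>Roots and restricted roots\<close>

text \<open>
  A linear functional on a subspace \<open>S\<close> is represented by its extension by zero outside \<open>S\<close>,
  so that functionals on \<open>S\<close> are equal iff they agree on \<open>S\<close>, and the pointwise operations
  of the imported theory of function algebras are those of the dual space.
\<close>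

definition functionals_on :: "(real^'n::finite) set \<Rightarrow> (real^'n \<Rightarrow> 'b::real_vector) set" where
  "functionals_on S = {f. (\<exists>g. linear g \<and> (\<forall>x\<in>S. f x = g x)) \<and> (\<forall>x. x \<notin> S \<longrightarrow> f x = 0)}"

definition cvec :: "real^'n::finite \<Rightarrow> real^'n \<Rightarrow> complex^'n" where
  "cvec u v = (\<chi> i. Complex (u $ i) (v $ i))"

text \<open>The complex bilinear extension of the bracket to the complexification \<open>complex^'n\<close>.\<close>

definition complex_bracket :: "'n::finite bracket \<Rightarrow> complex^'n \<Rightarrow> complex^'n \<Rightarrow> complex^'n" where
  "complex_bracket br z w =
     (let u = (\<chi> i. Re (z $ i)); v = (\<chi> i. Im (z $ i));
          u' = (\<chi> i. Re (w $ i)); v' = (\<chi> i. Im (w $ i))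
      in cvec (br u u' - br v v') (br u v' + br v u'))"

text \<open>
  A root is a complex linear functional on the complexification of the Cartan subalgebra \<open>h\<close>;
  it is recorded by its restriction to \<open>h\<close>, a complex-valued real linear functional,
  which determines it.
\<close>

definition root_space ::
    "'n::finite bracket \<Rightarrow> (real^'n) set \<Rightarrow> (real^'n \<Rightarrow> complex) \<Rightarrow> (complex^'n) set" where
  "root_space br h \<alpha> = {z. \<forall>H\<in>h. complex_bracket br (cvec H 0) z = \<alpha> H *s z}"

definition roots :: "'n::finite bracket \<Rightarrow> (real^'n) set \<Rightarrow> (real^'n \<Rightarrow> complex) set" where
  "roots br h = {\<alpha> \<in> functionals_on h. \<alpha> \<noteq> 0 \<and> root_space br h \<alpha> \<noteq> {0}}"

definition restricted_root_space ::
    "'n::finite bracket \<Rightarrow> (real^'n) set \<Rightarrow> (real^'n \<Rightarrow> real) \<Rightarrow> (real^'n) set" where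
  "restricted_root_space br a \<mu> = {x. \<forall>H\<in>a. br H x = \<mu> H *\<^sub>R x}"

definition restricted_roots :: "'n::finite bracket \<Rightarrow> (real^'n) set \<Rightarrow> (real^'n \<Rightarrow> real) set" where
  "restricted_roots br a = {\<mu> \<in> functionals_on a. \<mu> \<noteq> 0 \<and> restricted_root_space br a \<mu> \<noteq> {0}}"

text \<open>Roots are real-valued on \<open>a\<close>, so taking the real part here loses nothing.\<close>

definition restrict_root ::
    "(real^'n::finite) set \<Rightarrow> (real^'n \<Rightarrow> complex) \<Rightarrow> real^'n \<Rightarrow> real" where
  "restrict_root a \<alpha> = (\<lambda>H. if H \<in> a then Re (\<alpha> H) else 0)"

text \<open>
  The roots on which some functional that vanishes on no root is positive; on the lattice
  spanned by the roots, additive maps into the reals and linear functionals are the same.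
\<close>

definition positive_system :: "('v \<Rightarrow> 'b::ab_group_add) set \<Rightarrow> ('v \<Rightarrow> 'b) set \<Rightarrow> bool" where
  "positive_system R P \<longleftrightarrow>
     (\<exists>l :: ('v \<Rightarrow> 'b) \<Rightarrow> real. (\<forall>\<mu> \<nu>. l (\<mu> + \<nu>) = l \<mu> + l \<nu>) \<and>
        (\<forall>\<alpha>\<in>R. l \<alpha> \<noteq> 0) \<and> P = {\<alpha>\<in>R. l \<alpha> > 0})"

definition compatible_positive ::
    "(real^'n::finite) set \<Rightarrow> (real^'n \<Rightarrow> complex) set \<Rightarrow> (real^'n \<Rightarrow> real) set \<Rightarrow> bool" where
  "compatible_positive a \<Delta>p \<Sigma>p \<longleftrightarrow>
     (\<forall>\<alpha>\<in>\<Delta>p. restrict_root a \<alpha> \<noteq> 0 \<longrightarrow> restrict_root a \<alpha> \<in> \<Sigma>p)"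

definition real_root :: "'n::finite bracket \<Rightarrow> (real^'n) set \<Rightarrow> (real^'n \<Rightarrow> complex) \<Rightarrow> bool" where
  "real_root br h \<alpha> \<longleftrightarrow> \<alpha> \<in> roots br h \<and> (\<forall>H\<in>h. \<alpha> H \<in> \<real>)"

text \<open>The set \<open>{\<alpha> 1, \<dots>, \<alpha> j}\<close>, enumerated without repetition.\<close>

definition admissible_system ::
    "'n::finite bracket \<Rightarrow> (real^'n) set \<Rightarrow> (real^'n \<Rightarrow> complex) set \<Rightarrow> nat \<Rightarrow>
     (nat \<Rightarrow> real^'n \<Rightarrow> complex) \<Rightarrow> bool" where
  "admissible_system br h \<Delta>p j \<alpha> \<longleftrightarrow>
     inj_on \<alpha> {1..j} \<and>
     (\<forall>m\<in>{1..j}. \<alpha> m \<in> \<Delta>p \<and> real_root br h (\<alpha> m)) \<and>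
     (\<forall>i\<in>{1..j}. \<forall>k\<in>{1..j}. \<alpha> i + \<alpha> k \<notin> roots br h \<and> \<alpha> i - \<alpha> k \<notin> roots br h)"

text \<open>
  For a real root, \<open>root_dual\<close> is the element of \<open>h\<close> representing it with respect to the
  Killing form, and \<open>root_norm2\<close> is its squared length.
\<close>

definition root_dual :: "'n::finite bracket \<Rightarrow> (real^'n) set \<Rightarrow> (real^'n \<Rightarrow> complex) \<Rightarrow> real^'n" where
  "root_dual br h \<alpha> = (THE H. H \<in> h \<and> (\<forall>H'\<in>h. of_real (killing br H H') = \<alpha> H'))"

definition root_norm2 :: "'n::finite bracket \<Rightarrow> (real^'n) set \<Rightarrow> (real^'n \<Rightarrow> complex) \<Rightarrow> real" where
  "root_norm2 br h \<alpha> = killing br (root_dual br h \<alpha>) (root_dual br h \<alpha>)"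

definition normalized_root_vector ::
    "'n::finite bracket \<Rightarrow> (real^'n \<Rightarrow> real^'n) \<Rightarrow> (real^'n) set \<Rightarrow> (real^'n \<Rightarrow> complex) \<Rightarrow>
     real^'n \<Rightarrow> bool" where
  "normalized_root_vector br \<theta> h \<alpha> E \<longleftrightarrow>
     cvec E 0 \<in> root_space br h \<alpha> \<and> killing br E (\<theta> E) = - 2 / root_norm2 br h \<alpha>"

definition cayley_cartan ::
    "(real^'n::finite \<Rightarrow> real^'n) \<Rightarrow> (real^'n) set \<Rightarrow> nat \<Rightarrow> (nat \<Rightarrow> real^'n \<Rightarrow> complex) \<Rightarrow>
     (nat \<Rightarrow> real^'n) \<Rightarrow> (real^'n) set" where
  "cayley_cartan \<theta> h j \<alpha> E =
     {H + (\<Sum>m=1..j. c m *\<^sub>R (E m + \<theta> (E m))) | H c. H \<in> h \<and> (\<forall>m\<in>{1..j}. \<alpha> m H = 0)}"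


section \<open>The nilpotent subalgebra of an admissible system\<close>

text \<open>
  The first conjunct is condition (1) for \<open>\<mu> = \<beta> m\<close>, where \<open>\<mu> - \<beta> m\<close> is the zero weight of \<open>a\<close>,
  which never belongs to a set of positive restricted roots. It cannot be omitted: for
  \<open>sl(2, \<real>)\<close> and its positive root one would get the full nilradical, and the corresponding
  foliation of a sheet of the two-sheeted hyperboloid consists of parabolas. With it, the closure
  condition says that the sum of the restricted root spaces is normalized by the associated Cartan
  subalgebra, and a largest set always exists.
\<close>

definition nilpotent_conditions ::
    "(real^'n::finite \<Rightarrow> real) set \<Rightarrow> (nat \<Rightarrow> real^'n \<Rightarrow> real) \<Rightarrow> nat \<Rightarrow> (real^'n \<Rightarrow> real) set \<Rightarrow> bool" where
  "nilpotent_conditions R \<beta> n S \<longleftrightarrow>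
     (\<forall>m\<in>{1..n}. \<beta> m \<notin> S) \<and>
     (\<forall>m\<in>{1..n}. \<forall>\<mu>\<in>S. (\<mu> + \<beta> m \<in> R \<longrightarrow> \<mu> + \<beta> m \<in> S) \<and> (\<mu> - \<beta> m \<in> R \<longrightarrow> \<mu> - \<beta> m \<in> S)) \<and>
     (\<forall>m\<in>{1..n}. \<beta> m \<notin> {\<mu> + \<nu> | \<mu> \<nu>. \<mu> \<in> S \<and> \<nu> \<in> S} \<inter> R \<and>
                 - \<beta> m \<notin> {\<mu> + \<nu> | \<mu> \<nu>. \<mu> \<in> S \<and> \<nu> \<in> S} \<inter> R) \<and>
     {\<mu> + \<nu> | \<mu> \<nu>. \<mu> \<in> S \<and> \<nu> \<in> S} \<inter> R \<subseteq> S"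

definition nilpotent_chain ::
    "(real^'n::finite \<Rightarrow> real) set \<Rightarrow> (real^'n \<Rightarrow> real) set \<Rightarrow> nat \<Rightarrow> (nat \<Rightarrow> real^'n \<Rightarrow> real) \<Rightarrow>
     (nat \<Rightarrow> (real^'n \<Rightarrow> real) set) \<Rightarrow> bool" where
  "nilpotent_chain R Rp j \<beta> \<Sigma> \<longleftrightarrow> \<Sigma> 0 = Rp \<and>
     (\<forall>n\<in>{1..j}. \<Sigma> n \<subseteq> \<Sigma> (n - 1) \<and> nilpotent_conditions R \<beta> n (\<Sigma> n) \<and>
        (\<forall>S. S \<subseteq> \<Sigma> (n - 1) \<and> nilpotent_conditions R \<beta> n S \<longrightarrow> S \<subseteq> \<Sigma> n))"

definition nilpotent_subalgebra ::
    "'n::finite bracket \<Rightarrow> (real^'n) set \<Rightarrow> (real^'n \<Rightarrow> real) set \<Rightarrow> (real^'n) set" where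
  "nilpotent_subalgebra br a S = span (\<Union>\<mu>\<in>S. restricted_root_space br a \<mu>)"


section \<open>Foliations\<close>

text \<open>
  A flat chart \<open>(P, \<Phi>, S, K)\<close> of a \<open>d\<close>-dimensional submanifold \<open>M\<close> is a diffeomorphism \<open>\<Phi>\<close> of an
  open set \<open>P\<close> of the ambient space onto a convex open set that maps \<open>M \<inter> P\<close> to the
  \<open>d\<close>-dimensional slice by \<open>S\<close>; the plaques are the preimages of the slices of \<open>\<Phi> ` (M \<inter> P)\<close>
  parallel to \<open>K\<close>, and are connected by convexity.
\<close>

type_synonym 'e fchart = "'e set \<times> ('e \<Rightarrow> 'e) \<times> 'e set \<times> 'e set"

definition flat_chart :: "'e::euclidean_space set \<Rightarrow> nat \<Rightarrow> nat \<Rightarrow> 'e fchart \<Rightarrow> bool" where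
  "flat_chart M d k c \<longleftrightarrow> (case c of (P, \<Phi>, S, K) \<Rightarrow>
     open P \<and> open (\<Phi> ` P) \<and> convex (\<Phi> ` P) \<and> inj_on \<Phi> P \<and>
     smooth_on P \<Phi> \<and> smooth_on (\<Phi> ` P) (inv_into P \<Phi>) \<and>
     subspace S \<and> dim S = d \<and> \<Phi> ` (M \<inter> P) = \<Phi> ` P \<inter> S \<and>
     subspace K \<and> dim K = k \<and> K \<subseteq> S)"

definition same_plaque :: "'e::euclidean_space set \<Rightarrow> 'e fchart \<Rightarrow> ('e \<times> 'e) set" where
  "same_plaque M c = (case c of (P, \<Phi>, S, K) \<Rightarrow>
     {(y, z). y \<in> M \<inter> P \<and> z \<in> M \<inter> P \<and> \<Phi> z - \<Phi> y \<in> K})"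

text \<open>
  \<open>foliation M \<L> D\<close>: the set of leaves \<open>\<L>\<close> and the tangent distribution \<open>D\<close> form a foliation of
  the submanifold \<open>M\<close>, given by an atlas of flat charts. The charts are coherent because their
  plaques have the same tangent spaces \<open>D y\<close>; the leaves are the classes of points joined by
  a chain of plaques.
\<close>

definition foliation ::
    "'e::euclidean_space set \<Rightarrow> 'e set set \<Rightarrow> ('e \<Rightarrow> 'e set) \<Rightarrow> bool" where
  "foliation M \<L> D \<longleftrightarrow> (\<exists>d k C.
     (\<forall>c\<in>C. flat_chart M d k c) \<and>
     M \<subseteq> (\<Union>(P, \<Phi>, S, K)\<in>C. P) \<and>
     (\<forall>(P, \<Phi>, S, K)\<in>C. \<forall>y\<in>M \<inter> P. D y = {v. frechet_derivative \<Phi> (at y) v \<in> K}) \<and>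
     \<L> = M // (\<Union>c\<in>C. same_plaque M c)\<^sup>+)"

definition left_invariant ::
    "('g, 'b) monoid_scheme \<Rightarrow> ('g, 'n::finite) gchart \<Rightarrow> (real^'n) set \<Rightarrow>
     (real^'n \<Rightarrow> (real^'n) set) \<Rightarrow> bool" where
  "left_invariant G c \<Omega> D \<longleftrightarrow> (\<forall>g\<in>carrier G. \<forall>Y\<in>\<Omega>. D (Ad G c g Y) = Ad G c g ` D Y)"

text \<open>
  The value of the Kirillov form at \<open>Y\<close> on the tangent vectors \<open>br U Y\<close> and \<open>br V Y\<close>; by
  invariance of the Killing form, this formula holds at every point of the orbit.
\<close>

definition kirillov_form :: "'n::finite bracket \<Rightarrow> real^'n \<Rightarrow> real^'n \<Rightarrow> real^'n \<Rightarrow> real" where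
  "kirillov_form br Y U V = killing br Y (br U V)"

definition isotropic_distribution ::
    "'n::finite bracket \<Rightarrow> (real^'n) set \<Rightarrow> (real^'n \<Rightarrow> (real^'n) set) \<Rightarrow> bool" where
  "isotropic_distribution br \<Omega> D \<longleftrightarrow>
     (\<forall>Y\<in>\<Omega>. \<forall>U V. br U Y \<in> D Y \<longrightarrow> br V Y \<in> D Y \<longrightarrow> kirillov_form br Y U V = 0)"

definition affine_ruling :: "nat \<Rightarrow> 'e::euclidean_space set set \<Rightarrow> bool" where
  "affine_ruling n \<L> \<longleftrightarrow> (\<forall>L\<in>\<L>. affine L \<and> aff_dim L = int n)"


section \<open>Regular orbits\<close>

definition regular_orbit ::
    "('g, 'b) monoid_scheme \<Rightarrow> ('g, 'n::finite) gchart \<Rightarrow> 'n bracket \<Rightarrow> (real^'n) set \<Rightarrow> bool" where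
  "regular_orbit G c br \<Omega> \<longleftrightarrow> (\<exists>Z. regular_element br Z \<and> \<Omega> = adjoint_orbit G c Z)"

definition orbit_of_type ::
    "('g, 'b) monoid_scheme \<Rightarrow> ('g, 'n::finite) gchart \<Rightarrow> 'n bracket \<Rightarrow> (real^'n) set \<Rightarrow>
     (real^'n) set \<Rightarrow> bool" where
  "orbit_of_type G c br hF \<Omega> \<longleftrightarrow>
     (\<forall>Y\<in>\<Omega>. \<exists>g\<in>carrier G. stabilizer_algebra br Y = Ad G c g ` hF)"

end

theory Submission
  imports Defs
begin

text \<open>
  Write \<open>\<nn>\<close> for the nilpotent subalgebra. The Cartan subalgebra \<open>\<hh>\<^sub>F\<close> has only the weights \<open>0\<close>
  and \<open>\<plusminus>\<beta> m\<close> with respect to \<open>a\<close>, so by the closure conditions on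
  \<open>\<Sigma> j\<close> it normalizes \<open>\<nn>\<close>, and it is orthogonal to \<open>\<nn>\<close>; hence \<open>ad X\<close>
  is bijective on \<open>\<nn>\<close> and \<open>D X = [\<nn>, X] = \<nn>\<close>. Since \<open>exp (ad U)\<close> moves a point of \<open>X + \<nn>\<close> by
  \<open>[U, X]\<close> modulo the next term of the lower central series of \<open>\<nn>\<close>, the automorphisms
  \<open>exp (ad U)\<close> act transitively on \<open>X + \<nn>\<close>; they are of the form \<open>Ad g\<close> and preserve \<open>\<nn>\<close>, so
  \<open>X + \<nn>\<close> lies in the orbit and \<open>D\<close> is constantly \<open>\<nn>\<close> on it. An affine subspace contained in the
  orbit on which \<open>D\<close> is constantly its direction is a leaf. By invariance this holds at
  every point of the orbit, and isotropy follows from the vanishing of the Killing form on \<open>\<nn>\<close>.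
\<close>

section \<open>Affine leaves of a foliation\<close>

text \<open>The kernel of \<open>ad X\<close> is the Cartan subalgebra itself, which contains
  \<open>X\<close> because \<open>[X, X] = 0\<close>. Normalizing \<open>\<nn>\<close> and meeting
  it only in 0 therefore say that \<open>ad X\<close> maps \<open>\<nn>\<close> injectively into
  itself; finite dimension gives bijectivity, on \<open>\<nn>\<close> and on each term of its lower
  central series, so an error in reaching \<open>X + w\<close> can be removed one term at a time.
  Two obstacles shape the rest. The group is known only through charts, without an exponential map:
  an integral curve of a left-invariant field is available only for a short time, so a step by
  \<open>U\<close> is made as \<open>p\<close> iterations of an element at time
  \<open>1 / p\<close>. As \<open>ad U\<close> is nilpotent on the vectors concerned, the series are
  finite sums and no convergence question arises. The foliation too is known only through charts; an
  affine subspace is recognised as a leaf by a connectedness argument in which invariance of domain,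
  between spaces of equal dimension, supplies openness.\<close>

lemma smooth_on_imp_differentiable:
  assumes "smooth_on S f" "x \<in> S"
  shows "f differentiable (at x)"
  using assms(1)[unfolded smooth_on_def, rule_format, of "Suc 0"] assms(2) by simp

lemma smooth_on_has_derivative:
  assumes "smooth_on S f" "x \<in> S"
  shows "(f has_derivative frechet_derivative f (at x)) (at x)"
  using smooth_on_imp_differentiable[OF assms] frechet_derivative_works by blast

lemma smooth_on_continuous_on: "smooth_on S f \<Longrightarrow> continuous_on S f"
  by (meson continuous_at_imp_continuous_on differentiable_imp_continuous_within
      smooth_on_imp_differentiable)

text \<open>\<open>K\<close> is its own double orthogonal complement. Membership in \<open>K\<close>
  is thus tested by scalar functions, to which a zero-derivative argument applies.\<close>

lemma subspace_memberI_orthogonal: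
  fixes K :: "'e::euclidean_space set"
  assumes "subspace K" and "\<And>u. (\<And>k. k \<in> K \<Longrightarrow> u \<bullet> k = 0) \<Longrightarrow> u \<bullet> v = 0"
  shows "v \<in> K"
proof -
  have "v \<in> K\<^sup>\<bottom>\<^sup>\<bottom>"
    using assms(2) by (simp add: orthogonal_comp_def orthogonal_def) (metis inner_commute)
  then show ?thesis using orthogonal_comp_self[OF assms(1)] by simp
qed

text \<open>Differentiating \<open>inv_into P f \<circ> f = id\<close> near \<open>y\<close> gives a
  left inverse; equal finite dimensions give surjectivity.\<close>

lemma frechet_derivative_inverse_bij:
  fixes f :: "'e::euclidean_space \<Rightarrow> 'e"
  assumes "open P" "open (f ` P)" "inj_on f P" and "smooth_on P f" "smooth_on (f ` P) (inv_into P f)"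
    and "y \<in> P"
  shows "linear (frechet_derivative f (at y))" "bij (frechet_derivative f (at y))"
proof -
  let ?A = "frechet_derivative f (at y)" and ?B = "frechet_derivative (inv_into P f) (at (f y))"
  have A: "(f has_derivative ?A) (at y)"
    using assms smooth_on_has_derivative by blast
  have B: "(inv_into P f has_derivative ?B) (at (f y))"
    using assms smooth_on_has_derivative by blast
  show lin: "linear ?A" using A has_derivative_linear by blast
  have "(inv_into P f \<circ> f has_derivative ?B \<circ> ?A) (at y)"
    using A B by (rule diff_chain_at)
  then have "((\<lambda>x. x) has_derivative ?B \<circ> ?A) (at y)"
    by (rule has_derivative_transform_within_open[OF _ \<open>open P\<close> \<open>y \<in> P\<close>]) (simp add: assms)
  then have "?B \<circ> ?A = (\<lambda>x. x)"
    using has_derivative_unique[OF _ has_derivative_ident] by blast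
  then have "?B (?A v) = v" for v by (metis comp_apply)
  then have "inj ?A" by (rule inj_on_inverseI)
  then show "bij ?A" using lin linear_injective_imp_surjective by (blast intro: bijI)
qed

text \<open>Pairing \<Phi> along the segment with a vector normal to \<open>K\<close> gives a real
  function with derivative zero, hence constant.\<close>

lemma integral_segment_in_plaque:
  fixes \<Phi> :: "'e::euclidean_space \<Rightarrow> 'e"
  assumes "open P" "smooth_on P \<Phi>" "subspace K"
    and seg: "closed_segment y z \<subseteq> P"
    and tangent: "\<And>x. x \<in> closed_segment y z \<Longrightarrow> frechet_derivative \<Phi> (at x) (z - y) \<in> K"
  shows "\<Phi> z - \<Phi> y \<in> K"
proof (rule subspace_memberI_orthogonal[OF \<open>subspace K\<close>])
  fix u assume u: "\<And>k. k \<in> K \<Longrightarrow> u \<bullet> k = 0"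
  let ?p = "\<lambda>s::real. y + s *\<^sub>R (z - y)"
  have p: "?p s \<in> closed_segment y z" if "s \<in> {0..1}" for s
    using that by (auto simp: in_segment algebra_simps intro!: exI[of _ s])
  have "((\<lambda>s. u \<bullet> \<Phi> (?p s)) has_derivative (\<lambda>_. 0)) (at s within {0..1})" if s: "s \<in> {0..1}" for s
  proof -
    have d: "(\<Phi> has_derivative frechet_derivative \<Phi> (at (?p s))) (at (?p s))"
      using smooth_on_has_derivative[OF assms(2)] p[OF s] seg by blast
    have "(?p has_derivative (\<lambda>h. h *\<^sub>R (z - y))) (at s within {0..1})"
      by (auto intro!: derivative_eq_intros)
    from has_derivative_in_compose[OF this has_derivative_at_withinI[OF d]]
    have "((\<lambda>s. \<Phi> (?p s)) has_derivative (\<lambda>h. frechet_derivative \<Phi> (at (?p s)) (h *\<^sub>R (z - y))))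
        (at s within {0..1})" .
    then have "((\<lambda>s. u \<bullet> \<Phi> (?p s)) has_derivative
        (\<lambda>h. u \<bullet> frechet_derivative \<Phi> (at (?p s)) (h *\<^sub>R (z - y)))) (at s within {0..1})"
      by (rule has_derivative_inner_right)
    moreover have "u \<bullet> frechet_derivative \<Phi> (at (?p s)) (h *\<^sub>R (z - y)) = 0" for h
      using u[OF tangent[OF p[OF s]]] linear_scale[OF has_derivative_linear[OF d], of h "z - y"]
      by simp
    ultimately show ?thesis by simp
  qed
  then have "\<exists>c. \<forall>s\<in>{0..1}. u \<bullet> \<Phi> (?p s) = c"
    by (intro has_derivative_zero_constant) auto
  then obtain c where c: "\<And>s. s \<in> {0..1} \<Longrightarrow> u \<bullet> \<Phi> (?p s) = c" by blast
  have "u \<bullet> \<Phi> (?p 0) = u \<bullet> \<Phi> (?p 1)" using c[of 0] c[of 1] by simp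
  then show "u \<bullet> (\<Phi> z - \<Phi> y) = 0" by (simp add: inner_diff_right)
qed

lemma affine_translate_subspace:
  assumes "subspace W" shows "affine ((+) y ` W)"
  using affine_translation subspace_imp_affine[OF assms] by blast

text \<open>Clopen argument in chart coordinates: in the convex slice \<open>Q\<close> of the chart
  image by \<open>\<Phi> z + K\<close>, the points whose preimage lies in the affine subspace form a
  nonempty set, closed since affine subspaces are closed, and open by invariance of domain. So it is
  all of \<open>Q\<close>, which contains \<open>\<Phi> z'\<close>.\<close>

lemma plaque_subset_affine:
  fixes \<Phi> :: "'e::euclidean_space \<Rightarrow> 'e"
  assumes chart: "flat_chart M d k (P, \<Phi>, S, K)"
    and D: "\<And>x. x \<in> M \<inter> P \<Longrightarrow> D x = {v. frechet_derivative \<Phi> (at x) v \<in> K}"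
    and W: "subspace W" "(+) y ` W \<subseteq> M" "\<And>x. x \<in> (+) y ` W \<Longrightarrow> D x = W"
    and z: "z \<in> (+) y ` W" and zz': "(z, z') \<in> same_plaque M (P, \<Phi>, S, K)"
  shows "z' \<in> (+) y ` W"
proof -
  define L where "L = (+) y ` W"
  let ?\<Psi> = "inv_into P \<Phi>"
  have c: "open P" "open (\<Phi> ` P)" "convex (\<Phi> ` P)" "inj_on \<Phi> P" "smooth_on P \<Phi>"
    "smooth_on (\<Phi> ` P) ?\<Psi>" "subspace K"
    using chart by (auto simp: flat_chart_def)
  have zP: "z \<in> P" "z \<in> M" "z' \<in> P" "\<Phi> z' - \<Phi> z \<in> K"
    using zz' by (auto simp: same_plaque_def)
  have aL: "affine L" unfolding L_def using W(1) by (rule affine_translate_subspace)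
  have diffL: "x' - x \<in> W" if "x \<in> L" "x' \<in> L" for x x'
    using that W(1) by (auto simp: L_def subspace_diff)
  have LM: "L \<subseteq> M" and DL: "\<And>x. x \<in> L \<Longrightarrow> D x = W" and zL: "z \<in> L"
    using W z by (auto simp: L_def)
  \<comment> \<open>\<open>W\<close> is the preimage of \<open>K\<close> under the bijective
    differential at \<open>z\<close>. Invariance of domain below rests on this equality.\<close>
  have dimW: "dim W = dim K"
  proof -
    let ?A = "frechet_derivative \<Phi> (at z)"
    have A: "linear ?A" "bij ?A" using frechet_derivative_inverse_bij[OF c(1,2,4-6) zP(1)] .
    have "W = ?A -` K" using D[of z] DL[OF zL] zP by auto
    then have "?A ` W = K" using A(2) by (metis bij_is_surj surj_image_vimage_eq)
    then show ?thesis using A dim_image_eq[of ?A W] by (metis bij_is_inj inj_on_subset top_greatest)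
  qed
  define Q where "Q = \<Phi> ` P \<inter> (+) (\<Phi> z) ` K"
  have affK: "affine ((+) (\<Phi> z) ` K)" using c(7) by (rule affine_translate_subspace)
  have "convex Q" unfolding Q_def using c(3) affine_imp_convex[OF affK] by (rule convex_Int)
  have Q0: "\<Phi> z \<in> Q" using zP(1) subspace_0[OF c(7)] by (force simp: Q_def)
  have "\<Phi> z' \<in> (+) (\<Phi> z) ` K" using zP(4) by (rule rev_image_eqI) simp
  then have Q1: "\<Phi> z' \<in> Q" using zP by (simp add: Q_def)
  define Oq where "Oq = {q \<in> Q. ?\<Psi> q \<in> L}"
  have "continuous_on Q ?\<Psi>"
    using smooth_on_continuous_on[OF c(6)] by (rule continuous_on_subset) (auto simp: Q_def)
  moreover have "closed L" using aL affine_closed by blast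
  ultimately have clo: "closedin (top_of_set Q) Oq"
    using continuous_closedin_preimage[of Q ?\<Psi> L] by (simp add: Oq_def vimage_def Int_def conj_commute)
  have ope: "openin (top_of_set Q) Oq"
  proof (subst openin_subopen, intro ballI)
    fix q assume q: "q \<in> Oq"
    define p where "p = ?\<Psi> q"
    have "q \<in> \<Phi> ` P" using q by (simp add: Oq_def Q_def)
    then have pP: "p \<in> P" "\<Phi> p = q" by (auto simp: p_def inv_into_into f_inv_into_f)
    have pL: "p \<in> L" using q by (simp add: Oq_def p_def)
    obtain e where e: "e > 0" "ball p e \<subseteq> P" using \<open>open P\<close> pP open_contains_ball by blast
    define N where "N = L \<inter> ball p e"
    have NP: "N \<subseteq> P" using e by (auto simp: N_def)
    \<comment> \<open>The direction \<open>x - p\<close> lies in \<open>W\<close>, the value of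
      \<open>D\<close> along the whole segment, so the segment stays in one plaque.\<close>
    have img: "\<Phi> x \<in> (+) (\<Phi> z) ` K" if x: "x \<in> N" for x
    proof -
      have seg: "closed_segment p x \<subseteq> N"
        unfolding N_def using x pL \<open>e > 0\<close>
        by (intro closed_segment_subset convex_Int affine_imp_convex[OF aL] convex_ball) (auto simp: N_def)
      have "\<Phi> x - \<Phi> p \<in> K"
      proof (rule integral_segment_in_plaque[OF c(1,5,7)])
        show "closed_segment p x \<subseteq> P" using seg NP by blast
        fix w assume "w \<in> closed_segment p x"
        then have w: "w \<in> N" using seg by blast
        then have "x - p \<in> D w" using DL[of w] diffL[OF pL, of x] x by (auto simp: N_def)
        then show "frechet_derivative \<Phi> (at w) (x - p) \<in> K"
          using D[of w] w NP LM unfolding N_def by blast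
      qed
      moreover have "q \<in> (+) (\<Phi> z) ` K" using q by (simp add: Oq_def Q_def)
      then have "\<Phi> p - \<Phi> z \<in> K" using pP(2) by auto
      ultimately have "\<Phi> x - \<Phi> z \<in> K" using subspace_add[OF c(7)] by fastforce
      then show ?thesis by (auto simp: image_iff intro!: bexI[of _ "\<Phi> x - \<Phi> z"])
    qed
    have "openin (top_of_set ((+) (\<Phi> z) ` K)) (\<Phi> ` N)"
    proof (rule invariance_of_domain_affine_sets[OF _ aL affK])
      show "openin (top_of_set L) N" by (auto simp: N_def)
      have "aff_dim ((+) (\<Phi> z) ` K) = int (dim K)" 
        using aff_dim_translation_eq aff_dim_subspace[OF c(7)] by metis
      moreover have "aff_dim L = int (dim W)" 
        unfolding L_def using aff_dim_translation_eq aff_dim_subspace[OF W(1)] by metis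
      ultimately show "aff_dim ((+) (\<Phi> z) ` K) \<le> aff_dim L" using dimW by simp
      show "continuous_on N \<Phi>" using smooth_on_continuous_on[OF c(5)] NP continuous_on_subset by blast
      show "\<Phi> \<in> N \<rightarrow> (+) (\<Phi> z) ` K" using img by blast
      show "inj_on \<Phi> N" using c(4) NP inj_on_subset by blast
    qed
    moreover have "\<Phi> ` N \<subseteq> Q" using img NP by (auto simp: Q_def)
    ultimately have "openin (top_of_set Q) (\<Phi> ` N)"
      by (rule openin_subset_trans) (auto simp: Q_def)
    moreover have "q \<in> \<Phi> ` N" using pP pL e by (auto simp: N_def)
    moreover have "\<Phi> ` N \<subseteq> Oq" using \<open>\<Phi> ` N \<subseteq> Q\<close> NP c(4) by (auto simp: Oq_def N_def inv_into_f_f subset_iff)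
    ultimately show "\<exists>T. openin (top_of_set Q) T \<and> q \<in> T \<and> T \<subseteq> Oq" by blast
  qed
  have "\<Phi> z \<in> Oq" using Q0 zL zP c(4) by (simp add: Oq_def)
  then have "Oq = Q"
    using clo ope convex_connected[OF \<open>convex Q\<close>] unfolding connected_clopen by blast
  then have "?\<Psi> (\<Phi> z') \<in> L" using Q1 by (auto simp: Oq_def)
  then show ?thesis using zP c(4) by (simp add: L_def)
qed

text \<open>One inclusion follows a chain of plaques by induction. For the other, the affine
  subspace is connected and each of its points has a relative neighbourhood inside a single plaque,
  so being joined by a chain propagates from local to global.\<close>

lemma leaf_eq_affine:
  fixes M :: "'e::euclidean_space set"
  assumes charts: "\<And>c. c \<in> C \<Longrightarrow> flat_chart M d k c"
    and cover: "M \<subseteq> (\<Union>(P, \<Phi>, S, K)\<in>C. P)"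
    and D: "\<And>P \<Phi> S K x. (P, \<Phi>, S, K) \<in> C \<Longrightarrow> x \<in> M \<inter> P \<Longrightarrow>
      D x = {v. frechet_derivative \<Phi> (at x) v \<in> K}"
    and W: "subspace W" "(+) y ` W \<subseteq> M" "\<And>x. x \<in> (+) y ` W \<Longrightarrow> D x = W"
  shows "(\<Union>c\<in>C. same_plaque M c)\<^sup>+ `` {y} = (+) y ` W"
proof
  define R where "R = (\<Union>c\<in>C. same_plaque M c)"
  define L where "L = (+) y ` W"
  have yL: "y \<in> L" using subspace_0[OF W(1)] by (auto simp: L_def image_iff intro!: bexI[of _ 0])
  have aL: "affine L" unfolding L_def using W(1) by (rule affine_translate_subspace)
  have diffL: "x' - x \<in> W" if "x \<in> L" "x' \<in> L" for x x'
    using that W(1) by (auto simp: L_def subspace_diff)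
  have LM: "L \<subseteq> M" and DL: "\<And>x. x \<in> L \<Longrightarrow> D x = W"
    using W by (auto simp: L_def)
  have "(y, z) \<in> R\<^sup>+ \<Longrightarrow> z \<in> L" for z
  proof (induction rule: trancl_induct)
    case (base z)
    then show ?case
      using plaque_subset_affine[OF charts D W] yL unfolding R_def L_def by fast
  next
    case (step z z')
    then show ?case
      using plaque_subset_affine[OF charts D W] unfolding R_def L_def by fast
  qed
  then show "(\<Union>c\<in>C. same_plaque M c)\<^sup>+ `` {y} \<subseteq> (+) y ` W" by (auto simp: R_def L_def)
  have symR: "sym (R\<^sup>+)"
  proof (rule sym_trancl, rule symI)
    fix x z assume "(x, z) \<in> R"
    then obtain P \<Phi> S K where c: "(P, \<Phi>, S, K) \<in> C" "(x, z) \<in> same_plaque M (P, \<Phi>, S, K)"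
      by (auto simp: R_def)
    then have "subspace K" using charts by (fastforce simp: flat_chart_def)
    then have "(z, x) \<in> same_plaque M (P, \<Phi>, S, K)"
      using c(2) subspace_neg[of K] by (fastforce simp: same_plaque_def)
    then show "(z, x) \<in> R" using c(1) by (auto simp: R_def)
  qed
  have "(y, z) \<in> R\<^sup>+" if z: "z \<in> L" for z
  proof (rule connected_equivalence_relation[where R="\<lambda>x z. (x, z) \<in> R\<^sup>+" and S=L])
    show "connected L" using aL affine_imp_convex convex_connected by blast
    show "y \<in> L" "z \<in> L" by fact+
    show "\<And>x y. (x, y) \<in> R\<^sup>+ \<Longrightarrow> (y, x) \<in> R\<^sup>+" using symR by (rule symD)
    show "\<And>x y z. (x, y) \<in> R\<^sup>+ \<Longrightarrow> (y, z) \<in> R\<^sup>+ \<Longrightarrow> (x, z) \<in> R\<^sup>+" by (rule trancl_trans)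
    fix p assume p: "p \<in> L"
    then obtain P \<Phi> S K where c: "(P, \<Phi>, S, K) \<in> C" and pP: "p \<in> P" using cover LM by blast
    have cc: "open P" "smooth_on P \<Phi>" "subspace K" using charts[OF c] by (auto simp: flat_chart_def)
    obtain e where e: "e > 0" "ball p e \<subseteq> P" using \<open>open P\<close> pP open_contains_ball by blast
    define N where "N = L \<inter> ball p e"
    have "(p, x) \<in> R\<^sup>+" if x: "x \<in> N" for x
    proof -
      have seg: "closed_segment p x \<subseteq> N"
        unfolding N_def using x p \<open>e > 0\<close>
        by (intro closed_segment_subset convex_Int affine_imp_convex[OF aL] convex_ball) (auto simp: N_def)
      have "\<Phi> x - \<Phi> p \<in> K"
      proof (rule integral_segment_in_plaque[OF cc])
        show "closed_segment p x \<subseteq> P" using seg e by (auto simp: N_def)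
        fix w assume "w \<in> closed_segment p x"
        then have w: "w \<in> N" using seg by blast
        then have "x - p \<in> D w" using DL[of w] diffL[OF p, of x] x by (auto simp: N_def)
        then show "frechet_derivative \<Phi> (at w) (x - p) \<in> K"
          using D[OF c, of w] w e(2) LM unfolding N_def by blast
      qed
      then have "(p, x) \<in> same_plaque M (P, \<Phi>, S, K)"
        using x p pP e LM by (auto simp: same_plaque_def N_def)
      then show ?thesis using c by (auto simp: R_def)
    qed
    moreover have "openin (top_of_set L) N" "p \<in> N" using p e by (auto simp: N_def)
    ultimately show "\<exists>T. openin (top_of_set L) T \<and> p \<in> T \<and> (\<forall>x\<in>T. (p, x) \<in> R\<^sup>+)" by blast
  qed
  then show "(+) y ` W \<subseteq> (\<Union>c\<in>C. same_plaque M c)\<^sup>+ `` {y}" by (auto simp: R_def L_def)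
qed

text \<open>The only access to the atlas hidden in \<open>foliation\<close>: afterwards it is enough
  to exhibit one affine subspace through each point.\<close>

lemma foliation_affine_ruling:
  fixes M :: "'e::euclidean_space set"
  assumes "foliation M \<L> D"
    and int: "\<And>y. y \<in> M \<Longrightarrow> \<exists>W. subspace W \<and> dim W = n \<and> (+) y ` W \<subseteq> M \<and> (\<forall>x\<in>(+) y ` W. D x = W)"
  shows "affine_ruling n \<L>"
proof -
  obtain d k C where C: "\<forall>c\<in>C. flat_chart M d k c" "M \<subseteq> (\<Union>(P, \<Phi>, S, K)\<in>C. P)"
     "\<forall>(P, \<Phi>, S, K)\<in>C. \<forall>y\<in>M \<inter> P. D y = {v. frechet_derivative \<Phi> (at y) v \<in> K}"
     "\<L> = M // (\<Union>c\<in>C. same_plaque M c)\<^sup>+"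
    using assms(1) unfolding foliation_def by blast
  show ?thesis unfolding affine_ruling_def
  proof
    fix L assume "L \<in> \<L>"
    then obtain y where y: "y \<in> M" "L = (\<Union>c\<in>C. same_plaque M c)\<^sup>+ `` {y}"
      unfolding C(4) by (auto elim: quotientE)
    obtain W where W: "subspace W" "dim W = n" "(+) y ` W \<subseteq> M" "\<forall>x\<in>(+) y ` W. D x = W"
      using int[OF y(1)] by blast
    have "L = (+) y ` W"
      unfolding y(2) using C W by (intro leaf_eq_affine[of C M d k D W y]) blast+
    then show "affine L \<and> aff_dim L = int n"
      using affine_translate_subspace[OF W(1)] aff_dim_translation_eq[of y W] aff_dim_subspace[OF W(1)] W(2)
      by simp
  qed
qed

section \<open>Calculus of smooth maps and local solutions of differential equations\<close>

lemma smooth_on_frechet_derivative: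
  assumes "smooth_on S f" shows "smooth_on S (\<lambda>x. frechet_derivative f (at x) v)"
  unfolding smooth_on_def
proof
  fix n
  show "times_differentiable_on n S (\<lambda>x. frechet_derivative f (at x) v)"
    using assms[unfolded smooth_on_def, rule_format, of "Suc n"] by simp
qed

lemma differentiable_pair:
  assumes "f differentiable (at x within S)" "g differentiable (at x within S)"
  shows "(\<lambda>x. (f x, g x)) differentiable (at x within S)"
  using assms has_derivative_Pair unfolding differentiable_def by blast

lemma differentiable_eventually_in_open:
  assumes "p differentiable (at x)" "open S" "p x \<in> S"
  shows "\<forall>\<^sub>F y in at x. p y \<in> S"
proof -
  have "(p \<longlongrightarrow> p x) (at x)"
    using differentiable_imp_continuous_within[OF assms(1)] by (simp add: continuous_within)
  then show ?thesis using assms(2,3) by (rule topological_tendstoD)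
qed

text \<open>Expanding \<open>w x\<close> in a basis reduces the claim to directional derivatives in fixed directions.\<close>

lemma frechet_derivative_apply_differentiable:
  fixes f :: "'a::euclidean_space \<Rightarrow> 'b::real_normed_vector" and p w :: "'c::real_normed_vector \<Rightarrow> 'a"
  assumes f: "smooth_on S f" and S: "open S" "p x \<in> S"
    and p: "p differentiable (at x)" and w: "w differentiable (at x)"
  shows "(\<lambda>y. frechet_derivative f (at (p y)) (w y)) differentiable (at x)"
proof -
  define g where "g = (\<lambda>y. \<Sum>b\<in>Basis. (w y \<bullet> b) *\<^sub>R frechet_derivative f (at (p y)) b)"
  have "(\<lambda>y. frechet_derivative f (at (p y)) b) differentiable (at x)" for b
    using differentiable_chain_at[OF p smooth_on_imp_differentiable[OF smooth_on_frechet_derivative[OF f] S(2)]]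
    by (simp add: o_def)
  then have "g differentiable (at x)"
    unfolding g_def using w
    by (intro differentiable_sum differentiable_scaleR differentiable_inner ballI) auto
  then obtain D where D: "(g has_derivative D) (at x)" unfolding differentiable_def by blast
  have eq: "g y = frechet_derivative f (at (p y)) (w y)" if "p y \<in> S" for y
  proof -
    have lin: "linear (frechet_derivative f (at (p y)))"
      using smooth_on_has_derivative[OF f that] has_derivative_linear by blast
    have "frechet_derivative f (at (p y)) (w y) =
        frechet_derivative f (at (p y)) (\<Sum>b\<in>Basis. (w y \<bullet> b) *\<^sub>R b)"
      by (simp add: euclidean_representation)
    also have "\<dots> = g y" by (simp add: g_def linear_sum[OF lin] linear_scale[OF lin])
    finally show ?thesis ..
  qed
  have "\<forall>\<^sub>F y in at x. g y = frechet_derivative f (at (p y)) (w y)"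
    using differentiable_eventually_in_open[OF p S] by (rule eventually_mono) (rule eq)
  from has_derivative_transform_eventually[OF D this eq[OF S(2)]]
  show ?thesis by (auto simp: differentiable_def)
qed

text \<open>Compactness bounds the derivative in each basis direction, and the sum of these bounds
  controls the operator norm on a convex set. Continuity is asked direction by direction because
  \<open>times_differentiable_on\<close> provides it in that form.\<close>

lemma C1_lipschitz_on_cball:
  fixes F :: "'a::euclidean_space \<Rightarrow> 'b::real_normed_vector"
  assumes F: "\<And>x. x \<in> cball e r \<Longrightarrow> (F has_derivative F' x) (at x)"
    and F': "\<And>v. continuous_on (cball e r) (\<lambda>x. F' x v)"
  obtains B where "B > 0" "\<And>x y. x \<in> cball e r \<Longrightarrow> y \<in> cball e r \<Longrightarrow> norm (F x - F y) \<le> B * norm (x - y)"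
proof -
  have "\<exists>c. \<forall>x\<in>cball e r. norm (F' x b) \<le> c" for b
    using compact_imp_bounded[OF compact_continuous_image[OF F' compact_cball]]
    by (auto simp: bounded_iff)
  then obtain c where c: "\<And>b x. x \<in> cball e r \<Longrightarrow> norm (F' x b) \<le> c b" by metis
  \<comment> \<open>The added 1 makes \<open>B\<close> positive, so that it may be a divisor in the
    choice of a time interval.\<close>
  define B where "B = (\<Sum>b\<in>Basis. \<bar>c b\<bar>) + 1"
  have "norm (F x - F y) \<le> B * norm (x - y)" if "x \<in> cball e r" "y \<in> cball e r" for x y
  proof (rule differentiable_bound[OF convex_cball _ _ that])
    fix z assume z: "z \<in> cball e r"
    show "(F has_derivative F' z) (at z within cball e r)"
      using F[OF z] by (rule has_derivative_at_withinI)
    have lin: "linear (F' z)" using F[OF z] has_derivative_linear by blast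
    show "onorm (F' z) \<le> B"
    proof (rule onorm_le)
      fix v
      have "norm (F' z v) = norm (F' z (\<Sum>b\<in>Basis. (v \<bullet> b) *\<^sub>R b))"
        by (simp add: euclidean_representation)
      also have "\<dots> \<le> (\<Sum>b\<in>Basis. norm ((v \<bullet> b) *\<^sub>R F' z b))"
        unfolding linear_sum[OF lin] linear_scale[OF lin] by (rule norm_sum)
      also have "\<dots> \<le> (\<Sum>b\<in>Basis. norm v * \<bar>c b\<bar>)"
        using c[OF z] by (intro sum_mono) (auto intro!: mult_mono Basis_le_norm abs_ge_self intro: order_trans)
      also have "\<dots> \<le> B * norm v" by (simp add: B_def sum_distrib_left algebra_simps)
      finally show "norm (F' z v) \<le> B * norm v" .
    qed
  qed
  moreover have "B > 0" by (simp add: B_def add_nonneg_pos sum_nonneg)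
  ultimately show ?thesis using that by blast
qed

text \<open>Picard iteration on bounded continuous functions on the whole line: the vector field is
  made globally Lipschitz by composing it with the projection onto a ball, and time is clamped to
  \<open>[0, \<epsilon>]\<close>.\<close>

lemma picard_lindelof_local:
  fixes F :: "'a::euclidean_space \<Rightarrow> 'a"
  assumes "open Q" "e \<in> Q"
    and F: "\<And>x. x \<in> Q \<Longrightarrow> (F has_derivative F' x) (at x)"
    and F': "\<And>v. continuous_on Q (\<lambda>x. F' x v)"
  obtains \<epsilon> x where "\<epsilon> > 0" "x 0 = e" "\<And>t. t \<in> {0..\<epsilon>} \<Longrightarrow> x t \<in> Q"
    "\<And>t. t \<in> {0..\<epsilon>} \<Longrightarrow> (x has_vector_derivative F (x t)) (at t within {0..\<epsilon>})"
proof -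
  obtain r where r: "r > 0" "cball e r \<subseteq> Q" using assms(1,2) open_contains_cball by blast
  let ?D = "cball e r"
  have "continuous_on Q F"
    using F has_derivative_continuous continuous_at_imp_continuous_on by blast
  then have contF: "continuous_on ?D F" using r(2) continuous_on_subset by blast
  obtain M where M: "M > 0" "\<And>x. x \<in> ?D \<Longrightarrow> norm (F x) \<le> M"
    using compact_imp_bounded[OF compact_continuous_image[OF contF compact_cball]]
    by (auto simp: bounded_pos)
  obtain B where B: "B > 0" "\<And>x y. x \<in> ?D \<Longrightarrow> y \<in> ?D \<Longrightarrow> norm (F x - F y) \<le> B * norm (x - y)"
    using C1_lipschitz_on_cball[of e r F F'] F F' r(2) continuous_on_subset by blast
  \<comment> \<open>The first bound gives contraction factor 1/2, the second keeps the solution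
    inside the ball of radius \<open>r\<close>.\<close>
  define \<epsilon> where "\<epsilon> = min (1 / (2 * B)) (r / M)"
  have eps: "\<epsilon> > 0" "B * \<epsilon> \<le> 1 / 2" "M * \<epsilon> \<le> r"
    using r M B by (auto simp: \<epsilon>_def min_def field_simps)
  define H where "H x = F (closest_point ?D x)" for x
  have cp: "closest_point ?D x \<in> ?D" for x
    using r by (intro closest_point_in_set) auto
  have HM: "norm (H x) \<le> M" for x using M(2)[OF cp] by (simp add: H_def)
  have HB: "norm (H x - H y) \<le> B * norm (x - y)" for x y
  proof -
    have "norm (H x - H y) \<le> B * dist (closest_point ?D x) (closest_point ?D y)"
      using B(2)[OF cp cp] by (simp add: H_def dist_norm)
    also have "\<dots> \<le> B * dist x y"
      using B(1) r by (intro mult_left_mono closest_point_lipschitz) auto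
    finally show ?thesis by (simp add: dist_norm)
  qed
  have contH: "continuous_on UNIV H"
    unfolding H_def using r
    by (intro continuous_on_compose2[OF contF continuous_on_closest_point]) (auto intro: closest_point_in_set)
  define s where "s t = max 0 (min \<epsilon> t)" for t :: real
  have s: "s t \<in> {0..\<epsilon>}" "t \<in> {0..\<epsilon>} \<Longrightarrow> s t = t" for t using eps(1) by (auto simp: s_def)
  define P where "P x t = e + integral {0..s t} (\<lambda>u. H (x u))" for x :: "real \<Rightarrow> 'a" and t
  have contHx: "continuous_on K (\<lambda>u. H (apply_bcontfun x u))" for x :: "real \<Rightarrow>\<^sub>C 'a" and K
    by (rule continuous_on_compose2[OF contH]) auto
  have P: "P x \<in> bcontfun" for x :: "real \<Rightarrow>\<^sub>C 'a"
  proof -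
    have c0: "continuous_on {0..\<epsilon>} (\<lambda>w. e + integral {0..w} (\<lambda>u. H (x u)))"
      by (intro continuous_intros indefinite_integral_continuous_1 integrable_continuous_interval contHx)
    have "continuous_on UNIV s" unfolding s_def by (intro continuous_intros)
    then have "continuous_on UNIV (P x)"
      unfolding P_def using s(1) by (intro continuous_on_compose2[OF c0]) auto
    moreover have "bounded (range (P x))"
    proof (rule bounded_subset)
      show "bounded ((\<lambda>w. e + integral {0..w} (\<lambda>u. H (x u))) ` {0..\<epsilon>})"
        by (intro compact_imp_bounded compact_continuous_image c0 compact_Icc)
      show "range (P x) \<subseteq> (\<lambda>w. e + integral {0..w} (\<lambda>u. H (x u))) ` {0..\<epsilon>}"
        unfolding P_def using s(1) by blast
    qed
    ultimately show ?thesis by (simp add: bcontfun_def)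
  qed
  define \<P> where "\<P> x = Bcontfun (P (apply_bcontfun x))" for x
  have \<P>: "apply_bcontfun (\<P> x) = P x" for x :: "real \<Rightarrow>\<^sub>C 'a"
    unfolding \<P>_def using P Bcontfun_inverse by blast
  have "\<exists>!x :: real \<Rightarrow>\<^sub>C 'a. \<P> x = x"
  proof (rule banach_fix_type[of "1 / 2"], simp, simp, intro allI dist_bound)
    fix x y :: "real \<Rightarrow>\<^sub>C 'a" and t
    let ?d = "dist x y"
    have "dist (\<P> x t) (\<P> y t) = norm (integral {0..s t} (\<lambda>u. H (x u)) - integral {0..s t} (\<lambda>u. H (y u)))"
      unfolding \<P> P_def by (simp add: dist_norm)
    also have "\<dots> = norm (integral {0..s t} (\<lambda>u. H (x u) - H (y u)))"
      by (subst Henstock_Kurzweil_Integration.integral_diff) (auto intro!: integrable_continuous_interval contHx)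
    also have "\<dots> \<le> (B * ?d) * (s t - 0)"
    proof (rule integral_bound)
      show "0 \<le> s t" using s(1)[of t] by simp
      show "continuous_on {0..s t} (\<lambda>u. H (x u) - H (y u))" by (intro continuous_intros contHx)
      fix u
      have "norm (H (x u) - H (y u)) \<le> B * norm (x u - y u)" by (rule HB)
      also have "\<dots> \<le> B * ?d" using B(1) dist_bounded[of x u y] by (intro mult_left_mono) (auto simp: dist_norm)
      finally show "norm (H (x u) - H (y u)) \<le> B * ?d" .
    qed
    also have "\<dots> \<le> (B * ?d) * \<epsilon>" using s(1)[of t] B(1) by (intro mult_left_mono) auto
    also have "\<dots> = (B * \<epsilon>) * ?d" by simp
    also have "\<dots> \<le> 1 / 2 * ?d" using eps(2) by (rule mult_right_mono) simp
    finally show "dist (\<P> x t) (\<P> y t) \<le> 1 / 2 * ?d" .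
  qed
  then obtain x :: "real \<Rightarrow>\<^sub>C 'a" where "\<P> x = x" by blast
  then have x: "x t = e + integral {0..s t} (\<lambda>u. H (x u))" for t
    using \<P>[of x] unfolding P_def by metis
  have xe: "x t = e + integral {0..t} (\<lambda>u. H (x u))" if "t \<in> {0..\<epsilon>}" for t
    using x[of t] unfolding s(2)[OF that] .
  have inD: "x t \<in> ?D" if "t \<in> {0..\<epsilon>}" for t
  proof -
    have "norm (integral {0..t} (\<lambda>u. H (x u))) \<le> M * (t - 0)"
      using that HM by (intro integral_bound contHx) auto
    also have "\<dots> \<le> M * \<epsilon>" using that M(1) by (intro mult_left_mono) auto
    also have "\<dots> \<le> r" by (rule eps(3))
    finally show ?thesis by (subst xe[OF that]) (simp add: dist_norm)
  qed
  show thesis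
  proof
    show "\<epsilon> > 0" by (rule eps)
    show "x 0 = e" using xe[of 0] eps(1) by simp
    fix t assume t: "t \<in> {0..\<epsilon>}"
    show "x t \<in> Q" using inD[OF t] r by blast
    have "((\<lambda>w. integral {0..w} (\<lambda>u. H (x u))) has_vector_derivative H (x t)) (at t within {0..\<epsilon>})"
      using contHx t by (intro integral_has_vector_derivative)
    then have "((\<lambda>w. e + integral {0..w} (\<lambda>u. H (x u))) has_vector_derivative 0 + H (x t)) (at t within {0..\<epsilon>})"
      by (intro has_vector_derivative_add has_vector_derivative_const)
    moreover have "H (x t) = F (x t)" using closest_point_self[OF inD[OF t]] by (simp add: H_def)
    ultimately have "((\<lambda>w. e + integral {0..w} (\<lambda>u. H (x u))) has_vector_derivative F (x t)) (at t within {0..\<epsilon>})"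
      by simp
    then show "(x has_vector_derivative F (x t)) (at t within {0..\<epsilon>})"
      by (rule has_vector_derivative_transform[OF t, rotated]) (rule xe)
  qed
qed

section \<open>Lie algebras with a Cartan involution\<close>

locale real_lie_algebra =
  fixes br :: "'n::finite bracket"
  assumes lie: "lie_algebra br"
begin

lemma bilinear_br: "bilinear br"
  using lie by (simp add: lie_algebra_def)

lemma linear_br_right: "linear (br x)" and linear_br_left: "linear (\<lambda>x. br x y)"
  using bilinear_br by (auto simp: bilinear_def)

lemmas br_simps = bilinear_ladd[OF bilinear_br] bilinear_radd[OF bilinear_br]
  bilinear_lsub[OF bilinear_br] bilinear_rsub[OF bilinear_br]
  bilinear_lneg[OF bilinear_br] bilinear_rneg[OF bilinear_br]
  bilinear_lmul[OF bilinear_br] bilinear_rmul[OF bilinear_br]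
  bilinear_lzero[OF bilinear_br] bilinear_rzero[OF bilinear_br]

lemma br_self [simp]: "br x x = 0"
  using lie by (simp add: lie_algebra_def)

lemma br_skew: "br x y = - br y x"
proof -
  have "br (x + y) (x + y) = br x y + br y x" unfolding br_simps by simp
  then show ?thesis by (simp add: eq_neg_iff_add_eq_0)
qed

lemma br_eq_0_commute: "br x y = 0 \<longleftrightarrow> br y x = 0"
  using br_skew[of x y] by auto

lemma jacobi: "br x (br y z) = br (br x y) z + br y (br x z)"
proof -
  have "br x (br y z) + br y (br z x) + br z (br x y) = 0"
    using lie by (simp add: lie_algebra_def)
  then show ?thesis
    using br_skew[of z x] br_skew[of z "br x y"] by (simp add: br_simps algebra_simps)
qed

lemma killing_eq_sum: "killing br x y = (\<Sum>i\<in>UNIV. br x (br y (axis i 1)) $ i)"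
  by (simp add: killing_def trace_def matrix_def)

lemma killing_eq_trace: "killing br x y = trace (matrix (br x) ** matrix (br y))"
  by (simp add: killing_def matrix_compose linear_br_right)

lemma killing_commute: "killing br x y = killing br y x"
  unfolding killing_eq_trace by (rule trace_mul_sym)

lemma bilinear_killing: "bilinear (killing br)"
  unfolding bilinear_def
proof (intro conjI allI linearI)
qed (simp_all add: killing_eq_sum br_simps sum.distrib sum_distrib_left)

lemmas killing_simps = bilinear_ladd[OF bilinear_killing] bilinear_radd[OF bilinear_killing]
  bilinear_lsub[OF bilinear_killing] bilinear_rsub[OF bilinear_killing]
  bilinear_lneg[OF bilinear_killing] bilinear_rneg[OF bilinear_killing]
  bilinear_lmul[OF bilinear_killing] bilinear_rmul[OF bilinear_killing]
  bilinear_lzero[OF bilinear_killing] bilinear_rzero[OF bilinear_killing]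

text \<open>By Jacobi, \<open>ad [u, v]\<close> is the commutator of \<open>ad u\<close> and
  \<open>ad v\<close>; after expansion the two sides agree by cyclicity of the trace.\<close>

lemma killing_invariant: "killing br (br x y) z = killing br x (br y z)"
proof -
  have m: "matrix (br (br u v)) = matrix (br u) ** matrix (br v) - matrix (br v) ** matrix (br u)" for u v
  proof -
    have "matrix (br u) ** matrix (br v) = matrix (br u \<circ> br v)"
      "matrix (br v) ** matrix (br u) = matrix (br v \<circ> br u)"
      by (simp_all add: matrix_compose linear_br_right)
    moreover have "br (br u v) w = br u (br v w) - br v (br u w)" for w
      using jacobi[of u v w] by simp
    ultimately show ?thesis by (simp add: matrix_def vec_eq_iff)
  qed
  have "trace (matrix (br y) ** matrix (br x) ** matrix (br z)) =
      trace (matrix (br x) ** (matrix (br z) ** matrix (br y)))"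
    by (metis matrix_mul_assoc trace_mul_sym)
  moreover have "(A - B) ** C = A ** C - B ** C" "C ** (A - B) = C ** A - C ** B"
    for A B C :: "real^'n^'n"
    by (simp_all add: matrix_matrix_mult_def vec_eq_iff sum_subtractf algebra_simps)
  ultimately show ?thesis
    by (simp add: killing_eq_trace m trace_sub matrix_mul_assoc)
qed

text \<open>\<open>ad (A x)\<close> is the conjugate of \<open>ad x\<close> by \<open>A\<close>, and
  the trace is invariant under conjugation. Serves both \<theta> and the maps
  \<open>Ad g\<close>.\<close>

lemma killing_automorphism:
  assumes A: "linear A" "bij A" "\<And>x y. A (br x y) = br (A x) (A y)"
  shows "killing br (A x) (A y) = killing br x y"
proof -
  define A' where "A' = inv_into UNIV A"
  have inv: "\<And>x. A' (A x) = x" "\<And>x. A (A' x) = x"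
    using A(2) unfolding A'_def by (auto simp: bij_is_surj surj_f_inv_f bij_is_inj)
  have "linear A'"
    by (rule linearI) (metis inv linear_add[OF A(1)], metis inv linear_scale[OF A(1)])
  note A' = this inv
  have br: "br (A x) = A \<circ> br x \<circ> A'" for x
    by (simp add: fun_eq_iff A A')
  have "br (A x) \<circ> br (A y) = A \<circ> (br x \<circ> br y \<circ> A')"
    by (simp add: br fun_eq_iff A')
  then have "killing br (A x) (A y) = trace (matrix A ** matrix (br x \<circ> br y \<circ> A'))"
    unfolding killing_def
    by (simp add: matrix_compose linear_compose linear_br_right A A')
  also have "\<dots> = trace (matrix (br x \<circ> br y \<circ> A') ** matrix A)"
    by (rule trace_mul_sym)
  also have "\<dots> = trace (matrix (br x \<circ> br y \<circ> A' \<circ> A))"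
    by (simp add: matrix_compose linear_compose linear_br_right A A')
  also have "br x \<circ> br y \<circ> A' \<circ> A = br x \<circ> br y"
    by (simp add: fun_eq_iff A')
  finally show ?thesis unfolding killing_def .
qed

lemma lower_central_subspace: "subspace n \<Longrightarrow> subspace (lower_central br n k)"
  by (cases k) auto

lemma br_lower_central_Suc: "x \<in> n \<Longrightarrow> y \<in> lower_central br n k \<Longrightarrow> br x y \<in> lower_central br n (Suc k)"
  by (auto intro!: span_base)

lemma lower_central_subset:
  assumes "subspace n" "\<And>x y. x \<in> n \<Longrightarrow> y \<in> n \<Longrightarrow> br x y \<in> n"
  shows "lower_central br n k \<subseteq> n"
proof (induction k)
  case (Suc k)
  have "{br x y |x y. x \<in> n \<and> y \<in> lower_central br n k} \<subseteq> n" using Suc assms(2) by auto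
  then show ?case using span_minimal[OF _ assms(1)] by simp
qed simp

lemma lower_central_antimono:
  assumes "subspace n" "\<And>x y. x \<in> n \<Longrightarrow> y \<in> n \<Longrightarrow> br x y \<in> n"
  shows "lower_central br n (Suc k) \<subseteq> lower_central br n k"
proof (induction k)
  case 0
  then show ?case using lower_central_subset[OF assms, of "Suc 0"] by simp
next
  case (Suc k)
  show ?case unfolding lower_central.simps(2)[of br n "Suc k"]
  proof (rule span_minimal)
    show "{br x y |x y. x \<in> n \<and> y \<in> lower_central br n (Suc k)} \<subseteq> lower_central br n (Suc k)"
      using Suc br_lower_central_Suc by blast
    show "subspace (lower_central br n (Suc k))" using lower_central_subspace[OF assms(1)] .
  qed
qed

text \<open>\<open>ad z\<close> is a derivation preserving \<open>n\<close>, hence every subspace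
  built from \<open>n\<close> by brackets. With \<open>z = X\<close>, an approximation error can be
  solved for inside its own term of the series.\<close>

lemma lower_central_normalized:
  assumes "subspace n" "\<And>x. x \<in> n \<Longrightarrow> br z x \<in> n" and "x \<in> lower_central br n k"
  shows "br z x \<in> lower_central br n k"
  using assms(3)
proof (induction k arbitrary: x)
  case 0
  then show ?case using assms(2) by simp
next
  case (Suc k)
  let ?T = "lower_central br n (Suc k)"
  have T: "subspace ?T" using assms(1) by (rule lower_central_subspace)
  have "span {br x y |x y. x \<in> n \<and> y \<in> lower_central br n k} \<subseteq> br z -` ?T"
  proof (rule span_minimal)
    show "subspace (br z -` ?T)" using linear_br_right T by (rule linear_subspace_vimage)
    show "{br x y |x y. x \<in> n \<and> y \<in> lower_central br n k} \<subseteq> br z -` ?T"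
      using Suc.IH assms(2) br_lower_central_Suc
      by (auto simp: jacobi[of z] simp del: lower_central.simps intro!: subspace_add[OF T])
  qed
  then show ?case using Suc.prems by auto
qed

lemma br_image_eq:
  assumes "subspace S" "\<And>x. x \<in> S \<Longrightarrow> br z x \<in> S" "\<And>x. x \<in> S \<Longrightarrow> br z x = 0 \<Longrightarrow> x = 0"
  shows "br z ` S = S"
proof (rule subspace_dim_equal)
  show "subspace (br z ` S)" using linear_br_right assms(1) by (rule linear_subspace_image)
  have "inj_on (br z) S"
    using linear_injective_on_subspace_0[OF linear_br_right assms(1)] assms(3) by blast
  then show "dim S \<le> dim (br z ` S)"
    using dim_image_eq[OF linear_br_right, of z S] assms(1) by (simp add: span_eq_iff[THEN iffD2])
qed (use assms in auto)

end

section \<open>Cartan involutions and the inner product they define\<close>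

locale cartan_lie_algebra = real_lie_algebra +
  fixes \<theta> :: "real^'n \<Rightarrow> real^'n"
  assumes cartan: "cartan_involution br \<theta>"
begin

lemma linear_theta: "linear \<theta>" and theta_br: "\<theta> (br x y) = br (\<theta> x) (\<theta> y)"
  and theta_theta [simp]: "\<theta> (\<theta> x) = x"
  using cartan by (auto simp: cartan_involution_def)

text \<open>The standard inner product attached to a Cartan involution, positive definite by
  definition of the latter.\<close>

definition inner_theta :: "real^'n \<Rightarrow> real^'n \<Rightarrow> real" where
  "inner_theta x y = - killing br x (\<theta> y)"

lemma killing_theta: "killing br (\<theta> x) (\<theta> y) = killing br x y"
  using linear_theta theta_br by (intro killing_automorphism) (auto intro!: o_bij[of \<theta>])

lemma inner_theta_pos: "x \<noteq> 0 \<Longrightarrow> inner_theta x x > 0"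
  using cartan by (simp add: cartan_involution_def inner_theta_def)

lemma inner_theta_eq_0: "inner_theta x x = 0 \<Longrightarrow> x = 0"
  using inner_theta_pos by fastforce

lemma bilinear_inner_theta: "bilinear inner_theta"
  unfolding bilinear_def inner_theta_def
  by (auto intro!: linearI simp: killing_simps linear_add[OF linear_theta] linear_scale[OF linear_theta])

lemmas inner_theta_simps = bilinear_ladd[OF bilinear_inner_theta] bilinear_radd[OF bilinear_inner_theta]
  bilinear_lmul[OF bilinear_inner_theta] bilinear_rmul[OF bilinear_inner_theta]
  bilinear_lzero[OF bilinear_inner_theta] bilinear_rzero[OF bilinear_inner_theta]

text \<open>The sign \<open>s\<close> treats both eigenspaces of \<theta> at once:
  \<open>s = 1\<close> gives skew operators, \<open>s = -1\<close> symmetric ones.\<close>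

lemma inner_theta_ad:
  assumes "\<theta> H = s *\<^sub>R H" "s * s = 1"
  shows "inner_theta (br H x) y = - s * inner_theta x (br H y)"
proof -
  have "killing br (br H x) (\<theta> y) = - killing br x (br H (\<theta> y))"
    using br_skew[of H x] killing_invariant[of x H "\<theta> y"] by (simp add: killing_simps)
  moreover have "\<theta> (br H y) = s *\<^sub>R br H (\<theta> y)"
    by (simp add: theta_br assms br_simps)
  ultimately show ?thesis using assms(2) by (simp add: inner_theta_def killing_simps)
qed

text \<open>A symmetric or skew operator has no generalized kernel beyond its kernel:
  \<open>|ad H y|^2 = - s <y, (ad H)^2 y>\<close> lowers the exponent one at a time.\<close>

lemma ad_nilpotent_imp_0:
  assumes "\<theta> H = s *\<^sub>R H" "s * s = 1" "(br H ^^ Suc k) x = 0"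
  shows "br H x = 0"
  using assms(3)
proof (induction k)
  case (Suc k)
  let ?y = "(br H ^^ k) x"
  have "inner_theta (br H ?y) (br H ?y) = - s * inner_theta ?y (br H (br H ?y))"
    using inner_theta_ad[OF assms(1,2)] .
  also have "\<dots> = 0" using Suc.prems by (simp add: inner_theta_simps)
  finally have "br H ?y = 0" by (rule inner_theta_eq_0)
  then show ?case using Suc.IH by simp
qed simp

text \<open>The definition asks a Cartan subalgebra only to be nilpotent. The
  \<theta>-eigencomponents of \<open>x\<close> remain in \<open>h\<close> by stability; each acts
  nilpotently on \<open>y\<close> and therefore, being symmetric or skew, by zero.\<close>

lemma cartan_subalgebra_abelian:
  assumes h: "stable_cartan br \<theta> h" and x: "x \<in> h" and y: "y \<in> h"
  shows "br x y = 0"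
proof -
  obtain n where n: "lower_central br h n = {0}"
    and sub: "subspace h" and stab: "\<theta> ` h = h"
    using h by (auto simp: stable_cartan_def cartan_subalgebra_def)
  have 0: "0 \<in> lower_central br h (Suc n)"
    using subspace_0[OF lower_central_subspace[OF sub]] .
  have pow: "(br H ^^ k) y \<in> lower_central br h k" if "H \<in> h" for H k
    using that y by (induction k) (auto intro!: span_base)
  have part: "br H y = 0" if "H \<in> h" "\<theta> H = s *\<^sub>R H" "s * s = 1" for H s
  proof (rule ad_nilpotent_imp_0[OF that(2,3)])
    have "(br H ^^ n) y = 0" using pow[OF that(1), of n] n by simp
    then show "(br H ^^ Suc n) y = 0" by (simp add: br_simps)
  qed
  have tx: "\<theta> x \<in> h" using stab x by blast
  have "br (x + \<theta> x) y = 0"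
    by (rule part[of _ 1]) (use sub x tx in \<open>auto simp: subspace_add linear_add[OF linear_theta]\<close>)
  moreover have "br (x - \<theta> x) y = 0"
    by (rule part[of _ "-1"]) (use sub x tx in \<open>auto simp: subspace_diff linear_diff[OF linear_theta]\<close>)
  ultimately have "br ((x + \<theta> x) + (x - \<theta> x)) y = 0" unfolding br_simps by simp
  then have "br (2 *\<^sub>R x) y = 0" by (simp add: scaleR_2)
  then show ?thesis by (simp add: br_simps)
qed

end

context real_lie_algebra
begin

abbreviation "weight_space \<equiv> restricted_root_space br"

lemma subspace_weight_space: "subspace (weight_space a \<mu>)"
  by (auto simp: restricted_root_space_def subspace_def br_simps algebra_simps)

lemma br_weight_space:
  assumes "x \<in> weight_space a \<mu>" "y \<in> weight_space a \<nu>"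
  shows "br x y \<in> weight_space a (\<mu> + \<nu>)"
  using assms by (auto simp: restricted_root_space_def jacobi br_simps algebra_simps)

end

section \<open>Restricted root spaces\<close>

lemma functionals_on_add: "f \<in> functionals_on a \<Longrightarrow> g \<in> functionals_on a \<Longrightarrow> f + g \<in> functionals_on a"
proof -
  assume "f \<in> functionals_on a" "g \<in> functionals_on a"
  then obtain f' g' where "linear f'" "linear g'" "\<forall>x\<in>a. f x = f' x" "\<forall>x\<in>a. g x = g' x"
    "\<forall>x. x \<notin> a \<longrightarrow> f x = 0 \<and> g x = 0"
    by (auto simp: functionals_on_def)
  then show ?thesis
    unfolding functionals_on_def by (auto intro!: exI[of _ "\<lambda>x. f' x + g' x"] linear_compose_add)
qed

lemma functionals_on_uminus: "f \<in> functionals_on a \<Longrightarrow> - f \<in> functionals_on a"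
proof -
  assume "f \<in> functionals_on a"
  then obtain f' where "linear f'" "\<forall>x\<in>a. f x = f' x" "\<forall>x. x \<notin> a \<longrightarrow> f x = 0"
    by (auto simp: functionals_on_def)
  then show ?thesis
    unfolding functionals_on_def by (auto intro!: exI[of _ "\<lambda>x. - f' x"] linear_compose_neg)
qed

lemma functionals_on_neq: "f \<in> functionals_on a \<Longrightarrow> g \<in> functionals_on a \<Longrightarrow> f \<noteq> g \<Longrightarrow> \<exists>H\<in>a. f H \<noteq> g H"
  by (auto simp: functionals_on_def fun_eq_iff) metis

lemma restrict_root_functional:
  assumes "\<alpha> \<in> functionals_on h" "a \<subseteq> h"
  shows "restrict_root a \<alpha> \<in> functionals_on a"
proof -
  obtain g where g: "linear g" "\<forall>x\<in>h. \<alpha> x = g x" using assms by (auto simp: functionals_on_def)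
  have "linear (\<lambda>x. Re (g x))" using g(1) by (auto intro!: linearI simp: linear_add linear_scale)
  then show ?thesis
    using g assms(2) unfolding functionals_on_def restrict_root_def
    by (auto intro!: exI[of _ "\<lambda>x. Re (g x)"])
qed

text \<open>Reduces statements about \<open>\<nn>\<close> to restricted root vectors;
  \<open>T = {0}\<close> turns membership into vanishing of a form.\<close>

lemma bilinear_span_mem:
  fixes f :: "'a::real_vector \<Rightarrow> 'b::real_vector \<Rightarrow> 'c::real_vector"
  assumes f: "bilinear f" and T: "subspace T" and AB: "\<And>x y. x \<in> A \<Longrightarrow> y \<in> B \<Longrightarrow> f x y \<in> T"
    and x: "x \<in> span A" and y: "y \<in> span B"
  shows "f x y \<in> T"
proof -
  have lin: "linear (f u)" "linear (\<lambda>x. f x v)" for u v using f by (auto simp: bilinear_def)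
  have "span B \<subseteq> f u -` T" if "u \<in> A" for u :: 'a
    using AB that by (intro span_minimal linear_subspace_vimage lin T) auto
  then have "span A \<subseteq> (\<lambda>u. f u y) -` T"
    using y by (intro span_minimal linear_subspace_vimage lin T) auto
  then show ?thesis using x by auto
qed

context cartan_lie_algebra
begin

text \<open>Eigenvectors of the symmetric operator \<open>ad H\<close> for different eigenvalues are
  orthogonal.\<close>

lemma inner_theta_weight_spaces:
  assumes a: "a \<subseteq> p_part \<theta>" and x: "x \<in> weight_space a \<mu>" and y: "y \<in> weight_space a \<nu>"
    and H: "H \<in> a" "\<mu> H \<noteq> \<nu> H"
  shows "inner_theta x y = 0"
proof -
  have "inner_theta (br H x) y = inner_theta x (br H y)"
    using inner_theta_ad[of H "-1"] a H by (auto simp: p_part_def)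
  then show ?thesis using x y H by (auto simp: restricted_root_space_def inner_theta_simps)
qed

lemma theta_weight_space:
  assumes a: "a \<subseteq> p_part \<theta>" and x: "x \<in> weight_space a \<mu>"
  shows "\<theta> x \<in> weight_space a (- \<mu>)"
  unfolding restricted_root_space_def
proof (intro CollectI ballI)
  fix H assume H: "H \<in> a"
  have "\<theta> (br H x) = \<theta> (\<mu> H *\<^sub>R x)" using x H by (simp add: restricted_root_space_def)
  moreover have "\<theta> H = - H" using a H by (auto simp: p_part_def)
  ultimately have "- br H (\<theta> x) = \<mu> H *\<^sub>R \<theta> x"
    by (simp add: theta_br br_simps linear_scale[OF linear_theta])
  then have "br H (\<theta> x) = - (\<mu> H *\<^sub>R \<theta> x)" by (metis minus_minus)
  then show "br H (\<theta> x) = (- \<mu>) H *\<^sub>R \<theta> x" by simp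
qed

text \<open>\<theta> reverses weights, so the Killing form with \<open>y\<close> is, up to sign, the
  inner product with a vector of weight \<open>- \<nu>\<close>.\<close>

lemma killing_weight_spaces:
  assumes a: "a \<subseteq> p_part \<theta>" and x: "x \<in> weight_space a \<mu>" and y: "y \<in> weight_space a \<nu>"
    and H: "H \<in> a" "\<mu> H \<noteq> - \<nu> H"
  shows "killing br x y = 0"
  using inner_theta_weight_spaces[OF a x theta_weight_space[OF a y] H(1)] H(2)
  by (simp add: inner_theta_def)

text \<open>Vectors chosen from different restricted root spaces are orthogonal, hence independent,
  and the dimension bounds their number.\<close>

lemma finite_restricted_roots:
  assumes a: "a \<subseteq> p_part \<theta>"
  shows "finite (restricted_roots br a)"
proof -
  let ?R = "restricted_roots br a"
  have "\<exists>v. v \<in> weight_space a \<mu> \<and> v \<noteq> 0" if "\<mu> \<in> ?R" for \<mu>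
    using that subspace_0[OF subspace_weight_space, of a \<mu>] by (auto simp: restricted_roots_def)
  then obtain v where v: "\<And>\<mu>. \<mu> \<in> ?R \<Longrightarrow> v \<mu> \<in> weight_space a \<mu> \<and> v \<mu> \<noteq> 0" by metis
  have orth: "inner_theta (v \<mu>) (v \<nu>) = 0" if "\<mu> \<in> ?R" "\<nu> \<in> ?R" "\<mu> \<noteq> \<nu>" for \<mu> \<nu>
  proof -
    have "\<exists>H\<in>a. \<mu> H \<noteq> \<nu> H"
      using that by (intro functionals_on_neq) (auto simp: restricted_roots_def)
    then obtain H where "H \<in> a" "\<mu> H \<noteq> \<nu> H" by blast
    then show ?thesis using inner_theta_weight_spaces[OF a] v that by blast
  qed
  \<comment> \<open>A common vector for two roots would be orthogonal to itself.\<close>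
  have inj: "inj_on v ?R"
    using orth v inner_theta_eq_0 by (metis inj_onI)
  have "independent (v ` ?R)"
  proof
    assume "dependent (v ` ?R)"
    then obtain t u where t: "finite t" "t \<subseteq> v ` ?R" "(\<Sum>w\<in>t. u w *\<^sub>R w) = 0" "\<exists>w\<in>t. u w \<noteq> 0"
      unfolding dependent_explicit by blast
    then obtain w where w: "w \<in> t" "u w \<noteq> 0" by blast
    have lin: "linear (inner_theta w)" using bilinear_inner_theta by (simp add: bilinear_def)
    have "0 = inner_theta w (\<Sum>w\<in>t. u w *\<^sub>R w)" using t(3) by (simp add: inner_theta_simps)
    also have "\<dots> = (\<Sum>w'\<in>t. u w' * inner_theta w w')"
      by (simp add: linear_sum[OF lin] inner_theta_simps)
    also have "\<dots> = (\<Sum>w'\<in>t. if w' = w then u w * inner_theta w w else 0)"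
      using t(2) w(1) orth by (intro sum.cong refl) (auto; blast)
    also have "\<dots> = u w * inner_theta w w" using t(1) w(1) by simp
    finally have "w = 0" using w(2) inner_theta_eq_0 by simp
    then show False using w(1) t(2) v by auto
  qed
  then have "finite (v ` ?R)" by (rule finiteI_independent)
  then show ?thesis using inj by (rule finite_imageD)
qed

end

text \<open>The situation of \<open>\<Sigma> j\<close>: \<open>l\<close> is the additive function
  that defines positivity. As it is positive on \<open>S\<close>, sums of members of
  \<open>S\<close> are never zero, and it acts as a height that grows under brackets.\<close>

locale nilpotent_root_set = cartan_lie_algebra br \<theta> for br :: "'n::finite bracket" and \<theta> +
  fixes a :: "(real^'n) set" and S :: "(real^'n \<Rightarrow> real) set" and l :: "(real^'n \<Rightarrow> real) \<Rightarrow> real"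
  assumes a_p: "a \<subseteq> p_part \<theta>"
    and S_roots: "S \<subseteq> restricted_roots br a"
    and l_add: "l (\<mu> + \<nu>) = l \<mu> + l \<nu>"
    and l_pos: "\<mu> \<in> S \<Longrightarrow> l \<mu> > 0"
    and S_closed: "\<mu> \<in> S \<Longrightarrow> \<nu> \<in> S \<Longrightarrow> \<mu> + \<nu> \<in> restricted_roots br a \<Longrightarrow> \<mu> + \<nu> \<in> S"
begin

abbreviation "\<nn> \<equiv> nilpotent_subalgebra br a S"

lemma l_zero [simp]: "l 0 = 0"
  using l_add[of 0 0] by simp

lemma l_uminus: "l (- \<mu>) = - l \<mu>"
  using l_add[of \<mu> "- \<mu>"] by simp

lemma S_functional: "\<mu> \<in> S \<Longrightarrow> \<mu> \<in> functionals_on a"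
  using S_roots by (auto simp: restricted_roots_def)

lemma subspace_nil: "subspace \<nn>"
  by (simp add: nilpotent_subalgebra_def)

lemma weight_space_subset_nil: "\<mu> \<in> S \<Longrightarrow> weight_space a \<mu> \<subseteq> \<nn>"
  by (auto simp: nilpotent_subalgebra_def intro: span_base)

text \<open>A nonzero bracket is itself a vector of weight \<open>\<mu> + \<nu>\<close>, so this
  nonzero functional is a restricted root.\<close>

lemma sum_weight_mem:
  assumes "\<mu> \<in> functionals_on a" "\<nu> \<in> functionals_on a" "\<mu> + \<nu> \<noteq> 0"
    and "\<mu> + \<nu> \<in> restricted_roots br a \<Longrightarrow> \<mu> + \<nu> \<in> S"
    and "x \<in> weight_space a \<mu>" "y \<in> weight_space a \<nu>" "br x y \<noteq> 0"
  shows "\<mu> + \<nu> \<in> S"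
proof -
  have "br x y \<in> weight_space a (\<mu> + \<nu>)" using assms br_weight_space by blast
  then show ?thesis using assms functionals_on_add by (auto simp: restricted_roots_def)
qed

lemma br_nil: "x \<in> \<nn> \<Longrightarrow> y \<in> \<nn> \<Longrightarrow> br x y \<in> \<nn>"
  unfolding nilpotent_subalgebra_def
proof (rule bilinear_span_mem[OF bilinear_br subspace_span])
  fix x y assume "x \<in> (\<Union>\<mu>\<in>S. weight_space a \<mu>)" "y \<in> (\<Union>\<mu>\<in>S. weight_space a \<mu>)"
  then obtain \<mu> \<nu> where mn: "\<mu> \<in> S" "\<nu> \<in> S" "x \<in> weight_space a \<mu>" "y \<in> weight_space a \<nu>" by blast
  have "\<mu> + \<nu> \<noteq> 0" using l_pos[OF mn(1)] l_pos[OF mn(2)] l_add[of \<mu> \<nu>] by auto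
  then have "br x y \<noteq> 0 \<Longrightarrow> \<mu> + \<nu> \<in> S"
    using sum_weight_mem mn S_closed S_functional by blast
  then show "br x y \<in> span (\<Union>\<mu>\<in>S. weight_space a \<mu>)"
    using mn br_weight_space[OF mn(3,4)] by (cases "br x y = 0") (auto intro: span_zero span_base)
qed

text \<open>The Killing form pairs a weight only with its negative, and positivity of
  \<open>l\<close> prevents \<open>S\<close> from containing two opposite roots.\<close>

lemma killing_nil: "x \<in> \<nn> \<Longrightarrow> y \<in> \<nn> \<Longrightarrow> killing br x y = 0"
proof -
  assume n: "x \<in> \<nn>" "y \<in> \<nn>"
  have "killing br x y \<in> {0}"
  proof (rule bilinear_span_mem[OF bilinear_killing])
    show "x \<in> span (\<Union>\<mu>\<in>S. weight_space a \<mu>)" "y \<in> span (\<Union>\<mu>\<in>S. weight_space a \<mu>)"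
      using n by (simp_all add: nilpotent_subalgebra_def)
    fix x y assume "x \<in> (\<Union>\<mu>\<in>S. weight_space a \<mu>)" "y \<in> (\<Union>\<mu>\<in>S. weight_space a \<mu>)"
    then obtain \<mu> \<nu> where mn: "\<mu> \<in> S" "\<nu> \<in> S" "x \<in> weight_space a \<mu>" "y \<in> weight_space a \<nu>" by blast
    have "\<mu> \<noteq> - \<nu>" using l_pos[OF mn(1)] l_pos[OF mn(2)] l_uminus[of \<nu>] by auto
    then obtain H where "H \<in> a" "\<mu> H \<noteq> - \<nu> H"
      using functionals_on_neq[OF S_functional[OF mn(1)] functionals_on_uminus[OF S_functional[OF mn(2)]]]
      by auto
    then show "killing br x y \<in> {0}" using killing_weight_spaces[OF a_p mn(3,4)] by blast
  qed auto
  then show ?thesis by simp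
qed

text \<open>Every bracket with an element of \<open>\<nn>\<close> raises the value of \<open>l\<close> by at least its minimum on \<open>S\<close>.\<close>

lemma lower_central_nil: "\<exists>K. lower_central br \<nn> K = {0}"
proof -
  have fin: "finite S" using finite_restricted_roots[OF a_p] S_roots finite_subset by blast
  obtain \<delta> where d: "\<delta> > 0" "\<And>\<mu>. \<mu> \<in> S \<Longrightarrow> \<delta> \<le> l \<mu>"
  proof (cases "S = {}")
    case True
    then show ?thesis using that[of 1] by simp
  next
    case False
    have "Min (l ` S) > 0" using fin False l_pos by simp
    then show ?thesis using fin by (intro that[of "Min (l ` S)"]) auto
  qed
  have sub: "lower_central br \<nn> k \<subseteq> span (\<Union>\<mu>\<in>{\<mu> \<in> S. real k * \<delta> \<le> l \<mu>}. weight_space a \<mu>)" for k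
  proof (induction k)
    case 0
    have "{\<mu> \<in> S. real 0 * \<delta> \<le> l \<mu>} = S" using l_pos by force
    then show ?case by (simp add: nilpotent_subalgebra_def)
  next
    case (Suc k)
    let ?T = "\<lambda>k. (\<Union>\<mu>\<in>{\<mu> \<in> S. real k * \<delta> \<le> l \<mu>}. weight_space a \<mu>)"
    have "br x y \<in> span (?T (Suc k))" if x: "x \<in> \<nn>" and y: "y \<in> lower_central br \<nn> k" for x y
    proof (rule bilinear_span_mem[OF bilinear_br subspace_span])
      show "x \<in> span (\<Union>\<mu>\<in>S. weight_space a \<mu>)" using x by (simp add: nilpotent_subalgebra_def)
      show "y \<in> span (?T k)" using y Suc by blast
      fix x y assume "x \<in> (\<Union>\<mu>\<in>S. weight_space a \<mu>)" "y \<in> ?T k"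
      then obtain \<mu> \<nu> where mn: "\<mu> \<in> S" "\<nu> \<in> S" "real k * \<delta> \<le> l \<nu>"
        "x \<in> weight_space a \<mu>" "y \<in> weight_space a \<nu>" by blast
      have "\<mu> + \<nu> \<noteq> 0" using l_pos[OF mn(1)] l_pos[OF mn(2)] l_add[of \<mu> \<nu>] by auto
      then have "br x y \<noteq> 0 \<Longrightarrow> \<mu> + \<nu> \<in> S"
        using sum_weight_mem mn S_closed S_functional by blast
      moreover have "real (Suc k) * \<delta> \<le> l (\<mu> + \<nu>)"
        using mn(3) d(2)[OF mn(1)] l_add[of \<mu> \<nu>] by (simp add: algebra_simps)
      ultimately show "br x y \<in> span (?T (Suc k))"
        using br_weight_space[OF mn(4,5)] by (cases "br x y = 0") (auto intro: span_zero span_base)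
    qed
    then have "{br x y |x y. x \<in> \<nn> \<and> y \<in> lower_central br \<nn> k} \<subseteq> span (?T (Suc k))" by blast
    then show ?case unfolding lower_central.simps by (rule span_minimal) (rule subspace_span)
  qed
  \<comment> \<open>Beyond all values of \<open>l\<close> the filtration has no roots left and its
    span is 0; \<open>insert 0\<close> keeps \<open>Max\<close> meaningful for empty
    \<open>S\<close>.\<close>
  obtain K where K: "Max (insert 0 (l ` S)) < real K * \<delta>"
    using reals_Archimedean3[OF d(1)] by blast
  have "l \<mu> < real K * \<delta>" if "\<mu> \<in> S" for \<mu>
    using K fin that by (auto simp: Max_less_iff)
  then have "{\<mu> \<in> S. real K * \<delta> \<le> l \<mu>} = {}" by force
  then have "lower_central br \<nn> K \<subseteq> {0}" using sub[of K] by (metis UN_empty span_empty)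
  then show ?thesis using subspace_0[OF lower_central_subspace[OF subspace_nil], of K] by blast
qed

text \<open>Bracketing with \<open>z\<close> shifts weights by \<open>\<beta>\<close>. The third
  hypothesis excludes a shift to weight 0, where the bracket would fall in the centralizer of
  \<open>a\<close>.\<close>

lemma weight_vector_normalizes_nil:
  assumes "\<beta> \<in> functionals_on a" "z \<in> weight_space a \<beta>"
    and "\<And>\<mu>. \<mu> \<in> S \<Longrightarrow> \<mu> + \<beta> \<noteq> 0"
    and "\<And>\<mu>. \<mu> \<in> S \<Longrightarrow> \<mu> + \<beta> \<in> restricted_roots br a \<Longrightarrow> \<mu> + \<beta> \<in> S"
    and "x \<in> \<nn>"
  shows "br z x \<in> \<nn>"
proof -
  have "br x z \<in> \<nn>"
  proof (rule bilinear_span_mem[OF bilinear_br subspace_nil])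
    show "x \<in> span (\<Union>\<mu>\<in>S. weight_space a \<mu>)" using assms(5) by (simp add: nilpotent_subalgebra_def)
    show "z \<in> span {z}" by (simp add: span_base)
    fix x y assume "x \<in> (\<Union>\<mu>\<in>S. weight_space a \<mu>)" "y \<in> {z}"
    then obtain \<mu> where m: "\<mu> \<in> S" "x \<in> weight_space a \<mu>" and [simp]: "y = z" by blast
    have "br x z \<noteq> 0 \<Longrightarrow> \<mu> + \<beta> \<in> S"
      using sum_weight_mem[of \<mu> \<beta> x z] assms m S_functional by blast
    then show "br x y \<in> \<nn>"
      using br_weight_space[OF m(2) assms(2)] weight_space_subset_nil subspace_0[OF subspace_nil]
      by (cases "br x z = 0") auto
  qed
  then show ?thesis using br_skew[of z x] subspace_neg[OF subspace_nil] by simp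
qed

lemma weight_vector_orthogonal_nil:
  assumes "\<beta> \<in> functionals_on a" "z \<in> weight_space a \<beta>" "\<beta> \<notin> S" "x \<in> \<nn>"
  shows "inner_theta z x = 0"
proof -
  have "inner_theta z x \<in> {0}"
  proof (rule bilinear_span_mem[OF bilinear_inner_theta])
    show "x \<in> span (\<Union>\<mu>\<in>S. weight_space a \<mu>)" using assms(4) by (simp add: nilpotent_subalgebra_def)
    show "z \<in> span {z}" by (simp add: span_base)
    fix y x assume "x \<in> (\<Union>\<mu>\<in>S. weight_space a \<mu>)" "y \<in> {z}"
    then obtain \<mu> where m: "\<mu> \<in> S" "x \<in> weight_space a \<mu>" and [simp]: "y = z" by blast
    obtain H where "H \<in> a" "\<beta> H \<noteq> \<mu> H"
      using functionals_on_neq[OF assms(1) S_functional[OF m(1)]] assms(3) m(1) by blast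
    then show "inner_theta y x \<in> {0}" using inner_theta_weight_spaces[OF a_p assms(2) m(2)] by simp
  qed auto
  then show ?thesis by simp
qed

end

section \<open>Unipotent automorphisms and the Cartan subalgebra of an admissible system\<close>

context real_lie_algebra
begin

lemma ad_pow_lower_central:
  assumes "U \<in> n" "v \<in> lower_central br n k"
  shows "(br U ^^ i) v \<in> lower_central br n (k + i)"
  using assms by (induction i) (auto simp del: lower_central.simps intro!: br_lower_central_Suc)

text \<open>Write \<open>Y = X + v\<close>. The linear term of \<open>A Y\<close> is
  \<open>c 1\<close> times \<open>[U, X] + [U, v]\<close>, and \<open>[U, v]\<close> lies one step
  deeper because \<open>U\<close> is in term \<open>k\<close> and \<open>v\<close> in
  \<open>n\<close>. \<open>[U, Y]\<close> is in term \<open>k\<close>, so every further bracket with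
  \<open>U\<close> also gains a step. The coefficients \<open>c i\<close> later become
  \<open>t^i / i!\<close>.\<close>

lemma exp_nilpotent_shift:
  fixes c :: "nat \<Rightarrow> real"
  assumes n: "subspace n" "\<And>x y. x \<in> n \<Longrightarrow> y \<in> n \<Longrightarrow> br x y \<in> n"
    and K: "lower_central br n K = {0}"
    and X: "\<And>x. x \<in> n \<Longrightarrow> br X x \<in> n"
    and A: "\<And>Y k. (br U ^^ k) Y = 0 \<Longrightarrow> A Y = (\<Sum>i<k. c i *\<^sub>R (br U ^^ i) Y)" and c0: "c 0 = 1"
    and U: "U \<in> lower_central br n k"
  shows "A ` n \<subseteq> n"
    and "Y - X \<in> n \<Longrightarrow> A Y - Y - c 1 *\<^sub>R br U X \<in> lower_central br n (Suc k)"
    and "Y - X \<in> n \<Longrightarrow> A Y - X \<in> n"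
proof -
  let ?F = "lower_central br n"
  have F: "subspace (?F i)" for i using n(1) by (rule lower_central_subspace)
  have mono: "?F (i + k) \<subseteq> ?F k" for i k
    using lower_central_antimono[OF n] by (induction i) (auto simp del: lower_central.simps)
  have Fn: "?F i \<subseteq> n" for i using lower_central_subset[OF n] .
  have Un: "U \<in> n" using U Fn by blast
  have pow: "(br U ^^ i) v \<in> ?F (j + i)" if "v \<in> ?F j" for i j v
    using ad_pow_lower_central[OF Un that] .
  have pow0: "(br U ^^ K) v = 0" if "v \<in> n" for v
    using pow[of v 0 K] that K by simp
  show "A ` n \<subseteq> n"
  proof
    fix w assume "w \<in> A ` n"
    then obtain v where v: "v \<in> n" "w = A v" by blast
    have "(br U ^^ i) v \<in> n" for i using pow[of v 0 i] v(1) Fn by auto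
    then show "w \<in> n"
      unfolding v(2) A[OF pow0[OF v(1)]] by (intro subspace_sum subspace_scale n(1))
  qed
  have main: "A Y - Y - c 1 *\<^sub>R br U X \<in> ?F (Suc k)" "A Y - X \<in> n" if Y: "Y - X \<in> n" for Y
  proof -
    have UX: "br U X \<in> ?F k"
      using lower_central_normalized[OF n(1) X U] br_skew[of U X] subspace_neg[OF F] by simp
    have UYX: "br U (Y - X) \<in> ?F (Suc k)"
      using br_lower_central_Suc[OF Y U] br_skew[of U "Y - X"] subspace_neg[OF F]
      by (simp del: lower_central.simps)
    have UY_eq: "br U Y = br U X + br U (Y - X)" by (simp add: br_simps)
    have UY: "br U Y \<in> ?F k"
      unfolding UY_eq using UX UYX lower_central_antimono[OF n, of k] subspace_add[OF F]
      by (blast del: subsetD)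
    have UYn: "br U Y \<in> n" using UY Fn by blast
    \<comment> \<open>\<open>Y\<close> need not lie in \<open>n\<close>, but \<open>[U, Y]\<close>
      does and is killed by \<open>K\<close> more brackets. One further exponent is spent so that
      the terms of degree 0 and 1 split off even for \<open>K = 0\<close>.\<close>
    have "(br U ^^ Suc (Suc K)) Y = br U ((br U ^^ K) (br U Y))" by (simp add: funpow_swap1)
    also have "\<dots> = 0" using pow0[OF UYn] by (simp add: br_simps)
    finally have "A Y = (\<Sum>i<Suc (Suc K). c i *\<^sub>R (br U ^^ i) Y)" by (rule A)
    also have "\<dots> = Y + c 1 *\<^sub>R br U Y + (\<Sum>i<K. c (Suc (Suc i)) *\<^sub>R (br U ^^ Suc (Suc i)) Y)"
      by (simp only: sum.lessThan_Suc_shift) (simp add: c0)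
    finally have AY: "A Y - Y - c 1 *\<^sub>R br U X =
        c 1 *\<^sub>R br U (Y - X) + (\<Sum>i<K. c (Suc (Suc i)) *\<^sub>R (br U ^^ Suc (Suc i)) Y)"
      by (simp add: UY_eq scaleR_add_right)
    have "(br U ^^ Suc (Suc i)) Y \<in> ?F (Suc k)" for i
    proof -
      have "(br U ^^ Suc i) (br U Y) \<in> ?F (k + Suc i)" using pow[OF UY] .
      also have "k + Suc i = i + Suc k" by simp
      finally show ?thesis using mono[of i "Suc k"] by (auto simp: funpow_swap1 simp del: lower_central.simps)
    qed
    then show 1: "A Y - Y - c 1 *\<^sub>R br U X \<in> ?F (Suc k)"
      unfolding AY using UYX by (intro subspace_add subspace_sum subspace_scale F)
    have "A Y - X = (A Y - Y - c 1 *\<^sub>R br U X) + c 1 *\<^sub>R br U X + (Y - X)" by simp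
    also have "\<dots> \<in> n"
      using 1 UX Y Fn by (intro subspace_add subspace_scale n(1)) blast+
    finally show "A Y - X \<in> n" .
  qed
  then show "Y - X \<in> n \<Longrightarrow> A Y - Y - c 1 *\<^sub>R br U X \<in> ?F (Suc k)" "Y - X \<in> n \<Longrightarrow> A Y - X \<in> n"
    by blast+
qed

text \<open>Successive approximation: if \<open>B X\<close> equals \<open>X + w\<close> modulo term
  \<open>k\<close> of the lower central series, further factors improve this to term
  \<open>k + 1\<close>; at term \<open>K\<close> the error is 0. \<open>\<G>\<close> stands for the
  image of \<open>Ad\<close>, in which the exponential series is provided only at some time
  \<open>1 / p\<close>.\<close>

lemma unipotent_transitive:
  fixes \<G> :: "(real^'n \<Rightarrow> real^'n) set"
  assumes n: "subspace n" "\<And>x y. x \<in> n \<Longrightarrow> y \<in> n \<Longrightarrow> br x y \<in> n"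
    and K: "lower_central br n K = {0}"
    and X: "\<And>x. x \<in> n \<Longrightarrow> br X x \<in> n" "\<And>x. x \<in> n \<Longrightarrow> br X x = 0 \<Longrightarrow> x = 0"
    and id: "id \<in> \<G>" and comp: "\<And>A B. A \<in> \<G> \<Longrightarrow> B \<in> \<G> \<Longrightarrow> A \<circ> B \<in> \<G>"
    and exp: "\<And>U. U \<in> n \<Longrightarrow> \<exists>A\<in>\<G>. \<exists>p::nat. p > 0 \<and>
      (\<forall>Y k. (br U ^^ k) Y = 0 \<longrightarrow> A Y = (\<Sum>i<k. ((1 / real p) ^ i / fact i) *\<^sub>R (br U ^^ i) Y))"
    and w: "w \<in> n"
  shows "\<exists>A\<in>\<G>. A X = X + w \<and> A ` n \<subseteq> n"
proof -
  let ?F = "lower_central br n"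
  have F: "subspace (?F i)" for i using n(1) by (rule lower_central_subspace)
  have Fn: "?F i \<subseteq> n" for i using lower_central_subset[OF n] .
  have "\<exists>A\<in>\<G>. A X - (X + w) \<in> ?F k \<and> A ` n \<subseteq> n" for k
  proof (induction k)
    case 0
    show ?case using id w subspace_neg[OF n(1)] by (intro bexI[of _ id]) auto
  next
    case (Suc k)
    then obtain B where B: "B \<in> \<G>" "B X - (X + w) \<in> ?F k" "B ` n \<subseteq> n" by blast
    have "br X ` ?F k = ?F k"
      using Fn X lower_central_normalized[OF n(1) X(1)] by (intro br_image_eq F) blast+
    \<comment> \<open>\<open>ad X\<close> is bijective on term \<open>k\<close>, so the error is
      \<open>[X, U]\<close> for some \<open>U\<close> there; moving by \<open>[U, X]\<close> cancels
      it.\<close>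
    then obtain U where U: "U \<in> ?F k" "br X U = B X - (X + w)" using B(2) by (metis imageE)
    then obtain A p where A: "A \<in> \<G>" "(p::nat) > 0"
      "\<And>Y k. (br U ^^ k) Y = 0 \<Longrightarrow> A Y = (\<Sum>i<k. ((1 / real p) ^ i / fact i) *\<^sub>R (br U ^^ i) Y)"
      using exp Fn by blast
    note shift = exp_nilpotent_shift[OF n K X(1) A(3) _ U(1)]
    \<comment> \<open>Each of the \<open>p\<close> steps moves by \<open>[U, X] / p\<close> modulo
      term \<open>k + 1\<close>. The point remains in \<open>X + n\<close>, so the expansion applies
      again after every step.\<close>
    have "(A ^^ q) \<circ> B \<in> \<G> \<and> ((A ^^ q) \<circ> B) ` n \<subseteq> n \<and> (A ^^ q) (B X) - X \<in> n \<and>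
        (A ^^ q) (B X) - B X - (real q / real p) *\<^sub>R br U X \<in> ?F (Suc k)" for q
    proof (induction q)
      case 0
      have "B X - X = (B X - (X + w)) + w" by simp
      then have "B X - X \<in> n" using B(2) Fn w subspace_add[OF n(1)] by (metis subsetD)
      then show ?case using B subspace_0[OF F] by (simp del: lower_central.simps)
    next
      case (Suc q)
      let ?Y = "(A ^^ q) (B X)"
      have 1: "A ?Y - ?Y - (1 / real p) *\<^sub>R br U X \<in> ?F (Suc k)" "A ?Y - X \<in> n"
        using shift(2,3)[of ?Y] Suc.IH by (simp_all del: lower_central.simps)
      have "A ?Y - B X - (real (Suc q) / real p) *\<^sub>R br U X =
          (A ?Y - ?Y - (1 / real p) *\<^sub>R br U X) + (?Y - B X - (real q / real p) *\<^sub>R br U X)"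
        by (simp add: add_divide_distrib algebra_simps)
      also have "\<dots> \<in> ?F (Suc k)" using 1 Suc.IH by (intro subspace_add[OF F]) blast+
      finally have 2: "A ?Y - B X - (real (Suc q) / real p) *\<^sub>R br U X \<in> ?F (Suc k)" .
      have eq: "(A ^^ Suc q) \<circ> B = A \<circ> ((A ^^ q) \<circ> B)" by (simp add: comp_assoc)
      have "(A ^^ Suc q) \<circ> B \<in> \<G>" unfolding eq using comp[OF A(1)] Suc.IH by blast
      moreover have "((A ^^ Suc q) \<circ> B) ` n \<subseteq> n"
        unfolding eq using Suc.IH shift(1) by (auto simp: image_subset_iff)
      moreover have "(A ^^ Suc q) (B X) = A ?Y" by simp
      ultimately show ?case using 1 2 by presburger
    qed
    from this[of p] have q: "(A ^^ p) \<circ> B \<in> \<G>" "((A ^^ p) \<circ> B) ` n \<subseteq> n"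
      "(A ^^ p) (B X) - B X - br U X \<in> ?F (Suc k)" using A(2) by simp_all
    moreover have "(A ^^ p) (B X) - B X - br U X = ((A ^^ p) \<circ> B) X - (X + w)"
      using br_skew[of U X] U(2) by simp
    ultimately show ?case by (intro bexI[of _ "(A ^^ p) \<circ> B"]) (simp_all del: lower_central.simps)
  qed
  from this[of K] show ?thesis unfolding K by auto
qed


lemma real_root_vector_weight_space:
  assumes "cvec E 0 \<in> root_space br h \<alpha>" "a \<subseteq> h"
  shows "E \<in> weight_space a (restrict_root a \<alpha>)"
  unfolding restricted_root_space_def
proof (intro CollectI ballI)
  fix H assume H: "H \<in> a"
  have "complex_bracket br (cvec H 0) (cvec E 0) = cvec (br H E) 0"
    by (simp add: complex_bracket_def cvec_def br_simps Let_def zero_vec_def[symmetric])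
  then have "cvec (br H E) 0 = \<alpha> H *s cvec E 0"
    using assms H by (auto simp: root_space_def)
  then have "Re (cvec (br H E) 0 $ i) = Re ((\<alpha> H *s cvec E 0) $ i)" for i by simp
  then show "br H E = restrict_root a \<alpha> H *\<^sub>R E"
    using H by (simp add: cvec_def restrict_root_def vec_eq_iff)
qed

end

text \<open>\<open>H\<close> has weight 0 because \<open>h\<close> is abelian and contains
  \<open>a\<close>, while \<open>E m\<close> and \<open>\<theta> (E m)\<close> have weights
  \<open>\<beta> m\<close> and \<open>- \<beta> m\<close>. None of these weights is in
  \<open>S\<close>, so \<open>z\<close> is orthogonal to \<open>\<nn>\<close>; if it lies in
  \<open>\<nn>\<close>, it is orthogonal to itself.\<close>

lemma (in nilpotent_root_set) cayley_cartan_nil: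
  assumes h: "stable_cartan br \<theta> h" and a: "a = h \<inter> p_part \<theta>"
    and adm: "admissible_system br h \<Delta>p j \<alpha>"
    and E: "\<forall>m\<in>{1..j}. normalized_root_vector br \<theta> h (\<alpha> m) (E m)"
    and \<beta>: "\<beta> = (\<lambda>m. restrict_root a (\<alpha> m))"
    and pos: "\<And>m. m \<in> {1..j} \<Longrightarrow> \<beta> m \<noteq> 0 \<Longrightarrow> l (\<beta> m) > 0"
    and cond: "\<And>m. m \<in> {1..j} \<Longrightarrow> \<beta> m \<notin> S"
      "\<And>m \<mu>. m \<in> {1..j} \<Longrightarrow> \<mu> \<in> S \<Longrightarrow> \<mu> + \<beta> m \<in> restricted_roots br a \<Longrightarrow> \<mu> + \<beta> m \<in> S"
      "\<And>m \<mu>. m \<in> {1..j} \<Longrightarrow> \<mu> \<in> S \<Longrightarrow> \<mu> - \<beta> m \<in> restricted_roots br a \<Longrightarrow> \<mu> - \<beta> m \<in> S"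
    and z: "z \<in> cayley_cartan \<theta> h j \<alpha> E"
  shows "x \<in> \<nn> \<Longrightarrow> br z x \<in> \<nn>" and "z \<in> \<nn> \<Longrightarrow> z = 0"
proof -
  obtain H c where z_eq: "z = H + (\<Sum>m=1..j. c m *\<^sub>R (E m + \<theta> (E m)))" and H: "H \<in> h"
    using z by (auto simp: cayley_cartan_def)
  have Hw: "H \<in> weight_space a 0"
    using cartan_subalgebra_abelian[OF h _ H] a by (auto simp: restricted_root_space_def)
  have f0: "(0 :: real^'n \<Rightarrow> real) \<in> functionals_on a"
    by (auto simp: functionals_on_def intro!: exI[of _ "\<lambda>_. 0"] linearI)
  have ah: "a \<subseteq> h" using a by blast
  have Em: "\<beta> m \<in> functionals_on a" "E m \<in> weight_space a (\<beta> m)" "\<theta> (E m) \<in> weight_space a (- \<beta> m)"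
    if "m \<in> {1..j}" for m
  proof -
    have "\<alpha> m \<in> functionals_on h"
      using adm that by (auto simp: admissible_system_def real_root_def roots_def)
    then show "\<beta> m \<in> functionals_on a" unfolding \<beta> using ah by (rule restrict_root_functional)
    have "cvec (E m) 0 \<in> root_space br h (\<alpha> m)" using E that by (auto simp: normalized_root_vector_def)
    then show "E m \<in> weight_space a (\<beta> m)"
      unfolding \<beta> using ah by (rule real_root_vector_weight_space)
    then show "\<theta> (E m) \<in> weight_space a (- \<beta> m)" using theta_weight_space[OF a_p] by blast
  qed
  have S0: "0 \<notin> S" using l_pos[of 0] by auto
  have plus: "\<mu> + \<beta> m \<noteq> 0" if "m \<in> {1..j}" "\<mu> \<in> S" for m \<mu>
    using l_pos[OF that(2)] pos[OF that(1)] l_add[of \<mu> "\<beta> m"] by (cases "\<beta> m = 0") auto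
  \<comment> \<open>Positivity of \<open>l\<close> cannot exclude \<open>\<mu> = \<beta> m\<close>;
    this rests on the condition that keeps \<open>\<beta> m\<close> out of \<open>S\<close>.\<close>
  have minus: "\<mu> + - \<beta> m \<noteq> 0" if "m \<in> {1..j}" "\<mu> \<in> S" for m \<mu>
    using cond(1)[OF that(1)] that(2) by (metis add.right_neutral add_diff_cancel_left' diff_add_cancel uminus_add_conv_diff add.commute)
  have neg: "- \<beta> m \<notin> S" if "m \<in> {1..j}" for m
    using plus[OF that] by (metis add.left_inverse)
  have "br H x \<in> \<nn>" if "x \<in> \<nn>" for x
    using weight_vector_normalizes_nil[OF f0 Hw _ _ that] S0 by auto
  moreover have "br (E m) x \<in> \<nn>" if "m \<in> {1..j}" "x \<in> \<nn>" for m x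
    using weight_vector_normalizes_nil[OF Em(1,2)[OF that(1)] plus[OF that(1)] cond(2)[OF that(1)] that(2)] by blast
  moreover have "br (\<theta> (E m)) x \<in> \<nn>" if "m \<in> {1..j}" "x \<in> \<nn>" for m x
    using weight_vector_normalizes_nil[OF functionals_on_uminus[OF Em(1)[OF that(1)]] Em(3)[OF that(1)]
      minus[OF that(1)] _ that(2)] cond(3)[OF that(1)] by simp
  ultimately have parts: "br H x \<in> \<nn>" "m \<in> {1..j} \<Longrightarrow> br (E m + \<theta> (E m)) x \<in> \<nn>" if "x \<in> \<nn>" for x m
    using that subspace_add[OF subspace_nil] by (auto simp: br_simps)
  show "br z x \<in> \<nn>" if "x \<in> \<nn>"
  proof -
    have "br z x = br H x + (\<Sum>m=1..j. c m *\<^sub>R br (E m + \<theta> (E m)) x)"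
      unfolding z_eq by (simp add: br_simps linear_sum[OF linear_br_left])
    also have "\<dots> \<in> \<nn>"
      using parts[OF that] by (intro subspace_add subspace_sum subspace_scale subspace_nil)
    finally show ?thesis .
  qed
  show "z = 0" if z: "z \<in> \<nn>"
  proof -
    have lin: "linear (\<lambda>u. inner_theta u z)" using bilinear_inner_theta by (simp add: bilinear_def)
    have "inner_theta H z = 0"
      using weight_vector_orthogonal_nil[OF f0 Hw S0 z] .
    moreover have "inner_theta (E m) z = 0" "inner_theta (\<theta> (E m)) z = 0" if "m \<in> {1..j}" for m
      using weight_vector_orthogonal_nil[OF Em(1,2)[OF that] cond(1)[OF that] z]
        weight_vector_orthogonal_nil[OF functionals_on_uminus[OF Em(1)[OF that]] Em(3)[OF that] neg[OF that] z] .
    moreover have "inner_theta z z = inner_theta H z +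
        (\<Sum>m=1..j. c m * (inner_theta (E m) z + inner_theta (\<theta> (E m)) z))"
      by (subst z_eq) (simp add: inner_theta_simps linear_sum[OF lin])
    ultimately have "inner_theta z z = 0" by simp
    then show ?thesis by (rule inner_theta_eq_0)
  qed
qed

lemma (in cartan_lie_algebra) nilpotent_chain_nilpotent_root_set:
  assumes a: "a \<subseteq> p_part \<theta>" and pos: "positive_system (restricted_roots br a) \<Sigma>p"
    and chain: "nilpotent_chain (restricted_roots br a) \<Sigma>p j \<beta> \<Sigma>"
  obtains l where "nilpotent_root_set br \<theta> a (\<Sigma> j) l" "\<And>\<mu>. \<mu> \<in> \<Sigma>p \<Longrightarrow> l \<mu> > 0"
    "nilpotent_conditions (restricted_roots br a) \<beta> j (\<Sigma> j)"
proof -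
  let ?R = "restricted_roots br a"
  obtain l :: "(real^'n \<Rightarrow> real) \<Rightarrow> real"
    where l: "\<And>\<mu> \<nu>. l (\<mu> + \<nu>) = l \<mu> + l \<nu>" "\<Sigma>p = {\<alpha>\<in>?R. l \<alpha> > 0}"
    using pos unfolding positive_system_def by blast
  have sub: "n \<le> j \<Longrightarrow> \<Sigma> n \<subseteq> \<Sigma>p" for n
  proof (induction n)
    case 0
    then show ?case using chain by (simp add: nilpotent_chain_def)
  next
    case (Suc n)
    have "Suc n \<in> {1..j}" using Suc.prems by simp
    then have "\<Sigma> (Suc n) \<subseteq> \<Sigma> (Suc n - 1)" using chain unfolding nilpotent_chain_def by blast
    then show ?case using Suc by auto
  qed
  have cond: "nilpotent_conditions ?R \<beta> j (\<Sigma> j)"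
  \<comment> \<open>The chain imposes conditions only from index 1 on. For \<open>j = 0\<close> they
    reduce to additive closure of the positive system, which \<open>l\<close> gives.\<close>
  proof (cases "j = 0")
    case True
    then have "\<Sigma> j = \<Sigma>p" using chain by (simp add: nilpotent_chain_def)
    then show ?thesis using True l by (auto simp: nilpotent_conditions_def)
  next
    case False
    then show ?thesis using chain by (auto simp: nilpotent_chain_def)
  qed
  have closed: "\<mu> + \<nu> \<in> \<Sigma> j" if "\<mu> \<in> \<Sigma> j" "\<nu> \<in> \<Sigma> j" "\<mu> + \<nu> \<in> ?R" for \<mu> \<nu>
    using cond that unfolding nilpotent_conditions_def by blast
  have "nilpotent_root_set br \<theta> a (\<Sigma> j) l"
    using a l(2) sub[of j] closed
    by unfold_locales (auto simp: l(1))
  then show ?thesis using that l(2) cond by blast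
qed

section \<open>The adjoint representation of a Lie group\<close>

locale lie_group_chart =
  fixes G :: "('g, 'b) monoid_scheme" and T :: "'g topology" and A :: "('g, 'n::finite) gchart set"
    and U :: "'g set" and \<phi> :: "'g \<Rightarrow> real^'n"
  assumes lie_group: "lie_group G T A" and chart: "(U, \<phi>) \<in> A" and one_U: "\<one>\<^bsub>G\<^esub> \<in> U"
begin

lemma group_G: "group G" and topspace_T: "topspace T = carrier G" and atlas: "smooth_atlas T A"
  and continuous_mult: "continuous_map (prod_topology T T) T (\<lambda>(g, h). g \<otimes>\<^bsub>G\<^esub> h)"
  and continuous_inv: "continuous_map T T (\<lambda>g. inv\<^bsub>G\<^esub> g)"
  using lie_group by (auto simp: lie_group_def)

sublocale group G by (rule group_G)

lemma smooth_mult: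
  assumes "(V, \<psi>) \<in> A" "(W, \<eta>) \<in> A" "(Z, \<zeta>) \<in> A"
  shows "smooth_on {(x, y). x \<in> \<psi> ` V \<and> y \<in> \<eta> ` W \<and> inv_into V \<psi> x \<otimes>\<^bsub>G\<^esub> inv_into W \<eta> y \<in> Z}
          (\<lambda>(x, y). \<zeta> (inv_into V \<psi> x \<otimes>\<^bsub>G\<^esub> inv_into W \<eta> y))"
  using lie_group assms unfolding lie_group_def by blast

lemma smooth_inv:
  assumes "(V, \<psi>) \<in> A" "(W, \<eta>) \<in> A"
  shows "smooth_on {x. x \<in> \<psi> ` V \<and> inv\<^bsub>G\<^esub> (inv_into V \<psi> x) \<in> W} (\<lambda>x. \<eta> (inv\<^bsub>G\<^esub> (inv_into V \<psi> x)))"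
  using lie_group assms unfolding lie_group_def by blast

lemma chartD:
  assumes "(V, \<psi>) \<in> A"
  shows "openin T V" "open (\<psi> ` V)" "inj_on \<psi> V" "V \<subseteq> carrier G"
    "continuous_map (top_of_set (\<psi> ` V)) T (inv_into V \<psi>)"
proof -
  have c: "openin T V" "open (\<psi> ` V)" "homeomorphic_map (subtopology T V) (top_of_set (\<psi> ` V)) \<psi>"
    using atlas assms unfolding smooth_atlas_def by blast+
  then show "openin T V" "open (\<psi> ` V)" by auto
  show VG: "V \<subseteq> carrier G" using c(1) topspace_T openin_subset by blast
  then have ts: "topspace (subtopology T V) = V" by (auto simp: topspace_T)
  then show inj: "inj_on \<psi> V" using c(3) homeomorphic_imp_injective_map by fastforce
  obtain g where g: "homeomorphic_maps (subtopology T V) (top_of_set (\<psi> ` V)) \<psi> g"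
    using c(3) homeomorphic_map_maps by blast
  then have "continuous_map (top_of_set (\<psi> ` V)) (subtopology T V) g"
    by (simp add: homeomorphic_maps_def)
  then have "continuous_map (top_of_set (\<psi> ` V)) T g"
    by (simp add: continuous_map_in_subtopology)
  moreover have "g x = inv_into V \<psi> x" if "x \<in> \<psi> ` V" for x
  proof -
    obtain v where v: "v \<in> V" "x = \<psi> v" using \<open>x \<in> \<psi> ` V\<close> by blast
    then have "g x = v" using g ts by (simp add: homeomorphic_maps_def)
    then show ?thesis using v inj by simp
  qed
  ultimately show "continuous_map (top_of_set (\<psi> ` V)) T (inv_into V \<psi>)"
    by (rule continuous_map_eq) auto
qed

lemma chart_at:
  assumes "g \<in> carrier G" shows "\<exists>V \<psi>. (V, \<psi>) \<in> A \<and> g \<in> V"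
proof -
  have "(\<Union>(V, \<psi>)\<in>A. V) = carrier G"
    using atlas topspace_T unfolding smooth_atlas_def by simp
  then have "g \<in> (\<Union>(V, \<psi>)\<in>A. V)" using assms by simp
  then show ?thesis by auto
qed

text \<open>Continuity of multiplication and of the inverse charts gives openness, which allows
  coordinate identities on such domains to be differentiated.\<close>

lemma open_mult_domain:
  assumes V: "(V, \<psi>) \<in> A" and W: "(W, \<eta>) \<in> A" and Z: "openin T Z"
  shows "open {(x, y). x \<in> \<psi> ` V \<and> y \<in> \<eta> ` W \<and> inv_into V \<psi> x \<otimes>\<^bsub>G\<^esub> inv_into W \<eta> y \<in> Z}"
proof -
  let ?Q = "\<psi> ` V \<times> \<eta> ` W"
  have "continuous_map (top_of_set ?Q) (prod_topology T T) (\<lambda>z. (inv_into V \<psi> (fst z), inv_into W \<eta> (snd z)))"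
  proof (rule continuous_map_pairedI)
    have "continuous_map (top_of_set ?Q) (top_of_set (\<psi> ` V)) fst"
      by (auto intro: continuous_intros)
    from continuous_map_compose[OF this chartD(5)[OF V]]
    show "continuous_map (top_of_set ?Q) T (\<lambda>z. inv_into V \<psi> (fst z))" by (simp add: o_def)
    have "continuous_map (top_of_set ?Q) (top_of_set (\<eta> ` W)) snd"
      by (auto intro: continuous_intros)
    from continuous_map_compose[OF this chartD(5)[OF W]]
    show "continuous_map (top_of_set ?Q) T (\<lambda>z. inv_into W \<eta> (snd z))" by (simp add: o_def)
  qed
  then have "continuous_map (top_of_set ?Q) T
      ((\<lambda>(g, h). g \<otimes>\<^bsub>G\<^esub> h) \<circ> (\<lambda>z. (inv_into V \<psi> (fst z), inv_into W \<eta> (snd z))))"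
    using continuous_mult by (rule continuous_map_compose)
  then have "openin (top_of_set ?Q) {z \<in> topspace (top_of_set ?Q).
      ((\<lambda>(g, h). g \<otimes>\<^bsub>G\<^esub> h) \<circ> (\<lambda>z. (inv_into V \<psi> (fst z), inv_into W \<eta> (snd z)))) z \<in> Z}"
    using Z by (rule openin_continuous_map_preimage)
  moreover have "open ?Q" using chartD(2) V W by (blast intro: open_Times)
  ultimately have "open {z \<in> topspace (top_of_set ?Q).
      ((\<lambda>(g, h). g \<otimes>\<^bsub>G\<^esub> h) \<circ> (\<lambda>z. (inv_into V \<psi> (fst z), inv_into W \<eta> (snd z)))) z \<in> Z}"
    using openin_open_trans by blast
  also have "\<dots> = {(x, y). x \<in> \<psi> ` V \<and> y \<in> \<eta> ` W \<and> inv_into V \<psi> x \<otimes>\<^bsub>G\<^esub> inv_into W \<eta> y \<in> Z}"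
    by auto
  finally show ?thesis .
qed

lemma open_inv_domain:
  assumes V: "(V, \<psi>) \<in> A" and Z: "openin T Z"
  shows "open {x. x \<in> \<psi> ` V \<and> inv\<^bsub>G\<^esub> (inv_into V \<psi> x) \<in> Z}"
proof -
  have "continuous_map (top_of_set (\<psi> ` V)) T ((\<lambda>g. inv\<^bsub>G\<^esub> g) \<circ> inv_into V \<psi>)"
    using chartD(5)[OF V] continuous_inv by (rule continuous_map_compose)
  then have "openin (top_of_set (\<psi> ` V)) {x \<in> topspace (top_of_set (\<psi> ` V)).
     ((\<lambda>g. inv\<^bsub>G\<^esub> g) \<circ> inv_into V \<psi>) x \<in> Z}"
    using Z by (rule openin_continuous_map_preimage)
  then have "open {x \<in> topspace (top_of_set (\<psi> ` V)). ((\<lambda>g. inv\<^bsub>G\<^esub> g) \<circ> inv_into V \<psi>) x \<in> Z}"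
    using chartD(2)[OF V] openin_open_trans by blast
  also have "\<dots> = {x. x \<in> \<psi> ` V \<and> inv\<^bsub>G\<^esub> (inv_into V \<psi> x) \<in> Z}" by auto
  finally show ?thesis .
qed

section \<open>Multiplication and inversion in coordinates around the identity\<close>

abbreviation "pt \<equiv> inv_into U \<phi>"

text \<open>Charts are not assumed to be centred, so the identity may have any coordinates.\<close>

definition e0 :: "real^'n" where "e0 = \<phi> \<one>\<^bsub>G\<^esub>"

definition mu :: "(real^'n) \<times> (real^'n) \<Rightarrow> real^'n" where
  "mu = (\<lambda>(x, y). \<phi> (pt x \<otimes>\<^bsub>G\<^esub> pt y))"

definition mdom :: "((real^'n) \<times> (real^'n)) set" where
  "mdom = {(x, y). x \<in> \<phi> ` U \<and> y \<in> \<phi> ` U \<and> pt x \<otimes>\<^bsub>G\<^esub> pt y \<in> U}"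

definition iv :: "real^'n \<Rightarrow> real^'n" where "iv x = \<phi> (inv\<^bsub>G\<^esub> (pt x))"

definition idom :: "(real^'n) set" where "idom = {x. x \<in> \<phi> ` U \<and> inv\<^bsub>G\<^esub> (pt x) \<in> U}"

definition conj_chart :: "'g \<Rightarrow> real^'n \<Rightarrow> real^'n" where
  "conj_chart g x = \<phi> (g \<otimes>\<^bsub>G\<^esub> pt x \<otimes>\<^bsub>G\<^esub> inv\<^bsub>G\<^esub> g)"

abbreviation "AD \<equiv> Ad G (U, \<phi>)"
abbreviation "br \<equiv> lie_bracket G (U, \<phi>)"

lemma UG: "U \<subseteq> carrier G" and inj_phi: "inj_on \<phi> U" and openin_U: "openin T U"
  and open_phi_U: "open (\<phi> ` U)"
  using chartD[OF chart] by auto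

lemma pt_phi [simp]: "g \<in> U \<Longrightarrow> pt (\<phi> g) = g"
  using inj_phi by simp

lemma phi_pt [simp]: "x \<in> \<phi> ` U \<Longrightarrow> \<phi> (pt x) = x"
  by (rule f_inv_into_f)

lemma pt_U: "x \<in> \<phi> ` U \<Longrightarrow> pt x \<in> U"
  by (rule inv_into_into)

lemma pt_carrier: "x \<in> \<phi> ` U \<Longrightarrow> pt x \<in> carrier G"
  using pt_U UG by blast

lemma e0_mem: "e0 \<in> \<phi> ` U" and pt_e0 [simp]: "pt e0 = \<one>\<^bsub>G\<^esub>"
  using one_U by (auto simp: e0_def)

lemma mu_facts: "smooth_on mdom mu" "open mdom"
  using smooth_mult[OF chart chart chart] open_mult_domain[OF chart chart openin_U]
  by (simp_all add: mu_def mdom_def)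

lemma iv_facts: "smooth_on idom iv" "open idom"
proof -
  have "iv = (\<lambda>x. \<phi> (inv\<^bsub>G\<^esub> (pt x)))" by (simp add: fun_eq_iff iv_def)
  then show "smooth_on idom iv" "open idom"
    using smooth_inv[OF chart chart] open_inv_domain[OF chart openin_U]
    by (simp_all add: idom_def)
qed

lemma idom_phi_U: "x \<in> idom \<Longrightarrow> x \<in> \<phi> ` U" by (simp add: idom_def)

lemma e0_idom: "e0 \<in> idom"
  using e0_mem one_U by (simp add: idom_def)

lemma mdom_e0: "x \<in> \<phi> ` U \<Longrightarrow> (x, e0) \<in> mdom" and mu_e0: "x \<in> \<phi> ` U \<Longrightarrow> mu (x, e0) = x"
  using e0_mem pt_carrier pt_U by (auto simp: mdom_def mu_def)

lemma pt_iv: "x \<in> idom \<Longrightarrow> pt (iv x) = inv\<^bsub>G\<^esub> (pt x)"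
  by (simp add: idom_def iv_def)

lemma mdom_iv: "x \<in> idom \<Longrightarrow> (x, iv x) \<in> mdom"
proof -
  assume x: "x \<in> idom"
  then have "iv x \<in> \<phi> ` U" by (auto simp: idom_def iv_def)
  moreover have "pt x \<otimes>\<^bsub>G\<^esub> pt (iv x) = \<one>\<^bsub>G\<^esub>"
    using x pt_carrier by (simp add: pt_iv idom_def)
  ultimately show ?thesis using x one_U by (simp add: mdom_def idom_def)
qed

lemma pt_mu: "(x, y) \<in> mdom \<Longrightarrow> pt (mu (x, y)) = pt x \<otimes>\<^bsub>G\<^esub> pt y"
  by (simp add: mdom_def mu_def)

lemma conj_chart_e0: "g \<in> carrier G \<Longrightarrow> conj_chart g e0 = e0"
  by (simp add: conj_chart_def) (simp add: e0_def)

section \<open>The adjoint representation and its compatibility with the bracket\<close>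

lemma Ad_eq: "AD g = frechet_derivative (conj_chart g) (at e0)"
  by (simp add: Ad_def conj_chart_def[abs_def] e0_def)

lemma br_eq: "br u v = frechet_derivative (\<lambda>x. AD (pt x) v) (at e0) u"
  by (simp add: lie_bracket_def e0_def)

text \<open>\<open>g\<close> may lie outside \<open>U\<close>, so conjugation is factored through
  charts at \<open>g\<close> and at its inverse: left multiplication by \<open>g\<close> from
  \<open>U\<close> to \<open>V\<close>, then right multiplication by the inverse back into
  \<open>U\<close>.\<close>

lemma conj_chart_differentiable:
  assumes g: "g \<in> carrier G"
  shows "conj_chart g differentiable (at e0)"
proof -
  obtain V \<psi> where V: "(V, \<psi>) \<in> A" "g \<in> V" using chart_at[OF g] by blast
  obtain W \<eta> where W: "(W, \<eta>) \<in> A" "inv\<^bsub>G\<^esub> g \<in> W" using chart_at g by blast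
  let ?S1 = "{(x, y). x \<in> \<psi> ` V \<and> y \<in> \<phi> ` U \<and> inv_into V \<psi> x \<otimes>\<^bsub>G\<^esub> pt y \<in> V}"
  let ?S2 = "{(x, y). x \<in> \<psi> ` V \<and> y \<in> \<eta> ` W \<and> inv_into V \<psi> x \<otimes>\<^bsub>G\<^esub> inv_into W \<eta> y \<in> U}"
  let ?m1 = "\<lambda>(x, y). \<psi> (inv_into V \<psi> x \<otimes>\<^bsub>G\<^esub> pt y)"
  let ?m2 = "\<lambda>(x, y). \<phi> (inv_into V \<psi> x \<otimes>\<^bsub>G\<^esub> inv_into W \<eta> y)"
  have inv: "inv_into V \<psi> (\<psi> g) = g" "inv_into W \<eta> (\<eta> (inv\<^bsub>G\<^esub> g)) = inv\<^bsub>G\<^esub> g"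
    using V W chartD(3) by auto
  have 1: "(\<psi> g, e0) \<in> ?S1" using V e0_mem g by (simp add: inv)
  have 2: "(\<psi> g, \<eta> (inv\<^bsub>G\<^esub> g)) \<in> ?S2" using V W one_U g by (simp add: inv)
  have d1: "?m1 differentiable (at (\<psi> g, e0))"
    using smooth_mult[OF V(1) chart V(1)] 1 by (rule smooth_on_imp_differentiable)
  have d2: "?m2 differentiable (at (\<psi> g, \<eta> (inv\<^bsub>G\<^esub> g)))"
    using smooth_mult[OF V(1) W(1) chart] 2 by (rule smooth_on_imp_differentiable)
  define f1 where "f1 y = ?m1 (\<psi> g, y)" for y
  define f2 where "f2 x = ?m2 (x, \<eta> (inv\<^bsub>G\<^esub> g))" for x
  have f1: "f1 differentiable (at e0)"
    unfolding f1_def using differentiable_chain_at[of "\<lambda>y. (\<psi> g, y)" e0 ?m1] d1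
    by (simp add: o_def differentiable_pair)
  have f1e: "f1 e0 = \<psi> g" using g by (simp add: f1_def inv)
  have f2: "f2 differentiable (at (f1 e0))"
    unfolding f2_def f1e using differentiable_chain_at[of "\<lambda>x. (x, \<eta> (inv\<^bsub>G\<^esub> g))" "\<psi> g" ?m2] d2
    by (simp add: o_def differentiable_pair)
  have "(f2 \<circ> f1) differentiable (at e0)"
    using f1 f2 by (rule differentiable_chain_at)
  then obtain D where D: "((f2 \<circ> f1) has_derivative D) (at e0)" by (auto simp: differentiable_def)
  have eq: "(f2 \<circ> f1) y = conj_chart g y" if "(\<psi> g, y) \<in> ?S1" for y
    using that V chartD(3)[OF V(1)] by (simp add: f1_def f2_def inv conj_chart_def)
  have "\<forall>\<^sub>F y in at e0. (\<psi> g, y) \<in> ?S1"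
    using open_mult_domain[OF V(1) chart chartD(1)[OF V(1)]] 1
    by (intro differentiable_eventually_in_open differentiable_pair) auto
  then have "\<forall>\<^sub>F y in at e0. (f2 \<circ> f1) y = conj_chart g y" by (rule eventually_mono) (rule eq)
  from has_derivative_transform_eventually[OF D this eq[OF 1]]
  show ?thesis by (auto simp: differentiable_def)
qed

lemma conj_chart_has_derivative:
  "g \<in> carrier G \<Longrightarrow> (conj_chart g has_derivative AD g) (at e0)"
  unfolding Ad_eq using conj_chart_differentiable frechet_derivative_works by blast

lemma linear_Ad: "g \<in> carrier G \<Longrightarrow> linear (AD g)"
  using conj_chart_has_derivative has_derivative_linear by blast

lemma eventually_conj_in_U:
  assumes g: "g \<in> carrier G"
  shows "\<forall>\<^sub>F x in at e0. x \<in> \<phi> ` U \<and> g \<otimes>\<^bsub>G\<^esub> pt x \<otimes>\<^bsub>G\<^esub> inv\<^bsub>G\<^esub> g \<in> U"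
proof -
  have tr: "continuous_map T T (\<lambda>x. f x \<otimes>\<^bsub>G\<^esub> h x)" if "continuous_map T T f" "continuous_map T T h" for f h
    using continuous_map_compose[OF continuous_map_pairedI[OF that] continuous_mult] by (simp add: o_def)
  have c: "continuous_map T T (\<lambda>x. g \<otimes>\<^bsub>G\<^esub> x \<otimes>\<^bsub>G\<^esub> inv\<^bsub>G\<^esub> g)"
    using g by (intro tr) (auto simp: topspace_T)
  have "continuous_map (top_of_set (\<phi> ` U)) T ((\<lambda>x. g \<otimes>\<^bsub>G\<^esub> x \<otimes>\<^bsub>G\<^esub> inv\<^bsub>G\<^esub> g) \<circ> pt)"
    using chartD(5)[OF chart] c by (rule continuous_map_compose)
  then have "openin (top_of_set (\<phi> ` U)) {x \<in> topspace (top_of_set (\<phi> ` U)).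
     ((\<lambda>x. g \<otimes>\<^bsub>G\<^esub> x \<otimes>\<^bsub>G\<^esub> inv\<^bsub>G\<^esub> g) \<circ> pt) x \<in> U}"
    using openin_U by (rule openin_continuous_map_preimage)
  then have "open {x \<in> topspace (top_of_set (\<phi> ` U)). ((\<lambda>x. g \<otimes>\<^bsub>G\<^esub> x \<otimes>\<^bsub>G\<^esub> inv\<^bsub>G\<^esub> g) \<circ> pt) x \<in> U}"
    using open_phi_U openin_open_trans by blast
  moreover have "e0 \<in> {x \<in> topspace (top_of_set (\<phi> ` U)). ((\<lambda>x. g \<otimes>\<^bsub>G\<^esub> x \<otimes>\<^bsub>G\<^esub> inv\<^bsub>G\<^esub> g) \<circ> pt) x \<in> U}"
    using e0_mem one_U g by simp
  ultimately have "\<forall>\<^sub>F x in at e0. x \<in> {x \<in> topspace (top_of_set (\<phi> ` U)).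
     ((\<lambda>x. g \<otimes>\<^bsub>G\<^esub> x \<otimes>\<^bsub>G\<^esub> inv\<^bsub>G\<^esub> g) \<circ> pt) x \<in> U}"
    by (rule eventually_at_in_open')
  then show ?thesis by (rule eventually_mono) simp
qed

text \<open>Chain rule for composed conjugations. The coordinate expressions are composable where
  the inner conjugate stays in \<open>U\<close>, hence the passage to a neighbourhood of
  \<open>e0\<close>.\<close>

lemma Ad_mult:
  assumes g: "g \<in> carrier G" and h: "h \<in> carrier G"
  shows "AD (g \<otimes>\<^bsub>G\<^esub> h) = AD g \<circ> AD h"
proof -
  have "(conj_chart g has_derivative AD g) (at (conj_chart h e0))"
    using conj_chart_has_derivative[OF g] conj_chart_e0[OF h] by simp
  with conj_chart_has_derivative[OF h] have D: "(conj_chart g \<circ> conj_chart h has_derivative AD g \<circ> AD h) (at e0)"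
    by (rule diff_chain_at)
  have eq: "(conj_chart g \<circ> conj_chart h) x = conj_chart (g \<otimes>\<^bsub>G\<^esub> h) x"
    if "x \<in> \<phi> ` U \<and> h \<otimes>\<^bsub>G\<^esub> pt x \<otimes>\<^bsub>G\<^esub> inv\<^bsub>G\<^esub> h \<in> U" for x
  proof -
    have "pt (conj_chart h x) = h \<otimes>\<^bsub>G\<^esub> pt x \<otimes>\<^bsub>G\<^esub> inv\<^bsub>G\<^esub> h" using that by (simp add: conj_chart_def)
    moreover have "g \<otimes>\<^bsub>G\<^esub> (h \<otimes>\<^bsub>G\<^esub> pt x \<otimes>\<^bsub>G\<^esub> inv\<^bsub>G\<^esub> h) \<otimes>\<^bsub>G\<^esub> inv\<^bsub>G\<^esub> g
        = (g \<otimes>\<^bsub>G\<^esub> h) \<otimes>\<^bsub>G\<^esub> pt x \<otimes>\<^bsub>G\<^esub> inv\<^bsub>G\<^esub> (g \<otimes>\<^bsub>G\<^esub> h)"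
      using that g h pt_carrier by (simp add: inv_mult_group m_assoc)
    ultimately show ?thesis by (simp add: conj_chart_def[of g] conj_chart_def[of "g \<otimes>\<^bsub>G\<^esub> h"])
  qed
  have ev: "\<forall>\<^sub>F x in at e0. (conj_chart g \<circ> conj_chart h) x = conj_chart (g \<otimes>\<^bsub>G\<^esub> h) x"
    using eventually_conj_in_U[OF h] by (rule eventually_mono) (rule eq)
  have "(conj_chart (g \<otimes>\<^bsub>G\<^esub> h) has_derivative AD g \<circ> AD h) (at e0)"
    by (rule has_derivative_transform_eventually[OF D ev]) (use g h in \<open>simp_all add: conj_chart_e0\<close>)
  then show ?thesis
    using conj_chart_has_derivative g h has_derivative_unique by blast
qed

lemma Ad_one: "AD \<one>\<^bsub>G\<^esub> = id"
proof -
  have "((\<lambda>x. x) has_derivative (\<lambda>x. x)) (at e0)" by (rule has_derivative_ident)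
  then have "(conj_chart \<one>\<^bsub>G\<^esub> has_derivative (\<lambda>x. x)) (at e0)"
    by (rule has_derivative_transform_within_open[OF _ open_phi_U e0_mem])
      (simp add: conj_chart_def pt_carrier)
  then have "AD \<one>\<^bsub>G\<^esub> = (\<lambda>x. x)"
    using conj_chart_has_derivative[OF one_closed] has_derivative_unique by blast
  then show ?thesis by (simp add: id_def)
qed

lemma Ad_inv: "g \<in> carrier G \<Longrightarrow> AD (inv\<^bsub>G\<^esub> g) (AD g v) = v"
  "g \<in> carrier G \<Longrightarrow> AD g (AD (inv\<^bsub>G\<^esub> g) v) = v"
  using Ad_mult[of "inv\<^bsub>G\<^esub> g" g] Ad_mult[of g "inv\<^bsub>G\<^esub> g"] Ad_one by (simp_all add: fun_eq_iff)

lemma bij_Ad: "g \<in> carrier G \<Longrightarrow> bij (AD g)"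
  by (rule o_bij[of "AD (inv\<^bsub>G\<^esub> g)"]) (simp_all add: fun_eq_iff Ad_inv)

text \<open>Differential at the identity of left translation by \<open>pt x\<close>; for fixed
  \<open>v\<close> it is the left-invariant vector field with value \<open>v\<close> at the
  identity.\<close>

definition ltrans :: "real^'n \<Rightarrow> real^'n \<Rightarrow> real^'n" where
  "ltrans x v = frechet_derivative mu (at (x, e0)) (0, v)"

lemma mu_right_has_derivative:
  assumes "x \<in> \<phi> ` U" shows "((\<lambda>y. mu (x, y)) has_derivative ltrans x) (at e0)"
proof -
  have "(mu has_derivative frechet_derivative mu (at (x, e0))) (at (x, e0))"
    using mu_facts(1) mdom_e0[OF assms] by (rule smooth_on_has_derivative)
  moreover have "((\<lambda>y. (x, y)) has_derivative (\<lambda>v. (0, v))) (at e0)"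
    by (auto intro!: derivative_eq_intros)
  ultimately have "(mu \<circ> (\<lambda>y. (x, y)) has_derivative frechet_derivative mu (at (x, e0)) \<circ> (\<lambda>v. (0, v))) (at e0)"
    by (intro diff_chain_at)
  then show ?thesis by (simp add: o_def ltrans_def[abs_def])
qed

text \<open>In coordinates, conjugation by \<open>pt x\<close> sends \<open>y\<close> to
  \<open>mu (mu (x, y), iv x)\<close>. Expressing \<open>Ad\<close> by derivatives of the smooth map
  \<open>mu\<close> exposes its differentiable dependence on \<open>x\<close>, which gives the
  derivative defining the bracket its meaning.\<close>

lemma Ad_pt:
  assumes x: "x \<in> idom"
  shows "AD (pt x) v = frechet_derivative mu (at (x, iv x)) (ltrans x v, 0)"
proof -
  have xU: "x \<in> \<phi> ` U" using x by (rule idom_phi_U)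
  define f where "f y = (mu (x, y), iv x)" for y
  have f: "(f has_derivative (\<lambda>v. (ltrans x v, 0))) (at e0)"
    unfolding f_def using mu_right_has_derivative[OF xU] by (intro has_derivative_Pair) auto
  have fe: "f e0 = (x, iv x)" using mu_e0[OF xU] by (simp add: f_def)
  have "(mu has_derivative frechet_derivative mu (at (x, iv x))) (at (f e0))"
    unfolding fe using mu_facts(1) mdom_iv[OF x] by (rule smooth_on_has_derivative)
  with f have D: "(mu \<circ> f has_derivative frechet_derivative mu (at (x, iv x)) \<circ> (\<lambda>v. (ltrans x v, 0))) (at e0)"
    by (rule diff_chain_at)
  have eq: "(mu \<circ> f) y = conj_chart (pt x) y" if "(x, y) \<in> mdom" for y
    using that x by (simp add: f_def conj_chart_def mu_def mdom_def pt_iv)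
  have "\<forall>\<^sub>F y in at e0. (x, y) \<in> mdom"
    using mu_facts(2) mdom_e0[OF xU] by (intro differentiable_eventually_in_open differentiable_pair) auto
  then have ev: "\<forall>\<^sub>F y in at e0. (mu \<circ> f) y = conj_chart (pt x) y" by (rule eventually_mono) (rule eq)
  have "(conj_chart (pt x) has_derivative frechet_derivative mu (at (x, iv x)) \<circ> (\<lambda>v. (ltrans x v, 0))) (at e0)"
    by (rule has_derivative_transform_eventually[OF D ev eq[OF mdom_e0[OF xU]]]) simp
  then have "AD (pt x) = frechet_derivative mu (at (x, iv x)) \<circ> (\<lambda>v. (ltrans x v, 0))"
    using conj_chart_has_derivative[OF pt_carrier[OF xU]] has_derivative_unique by blast
  then show ?thesis by simp
qed

lemma ltrans_differentiable:
  assumes "x \<in> \<phi> ` U" shows "(\<lambda>y. ltrans y v) differentiable (at x)"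
  unfolding ltrans_def
  by (rule frechet_derivative_apply_differentiable[OF mu_facts])
    (auto intro!: differentiable_pair mdom_e0 assms)

lemma Ad_pt_differentiable:
  assumes x: "x \<in> idom" shows "(\<lambda>y. AD (pt y) v) differentiable (at x)"
proof -
  have "(\<lambda>y. frechet_derivative mu (at (y, iv y)) (ltrans y v, 0)) differentiable (at x)"
    by (rule frechet_derivative_apply_differentiable[OF mu_facts])
      (auto intro!: differentiable_pair mdom_iv x ltrans_differentiable idom_phi_U
         smooth_on_imp_differentiable[OF iv_facts(1)])
  then obtain D where "((\<lambda>y. frechet_derivative mu (at (y, iv y)) (ltrans y v, 0)) has_derivative D) (at x)"
    by (auto simp: differentiable_def)
  then have "((\<lambda>y. AD (pt y) v) has_derivative D) (at x)"
    by (rule has_derivative_transform_within_open[OF _ iv_facts(2) x]) (simp add: Ad_pt)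
  then show ?thesis by (auto simp: differentiable_def)
qed

lemma Ad_pt_has_derivative_br: "((\<lambda>x. AD (pt x) v) has_derivative (\<lambda>u. br u v)) (at e0)"
  unfolding br_eq using Ad_pt_differentiable[OF e0_idom] frechet_derivative_works by blast

text \<open>Differentiate \<open>Ad (g x g^-1) (Ad g v) = Ad g (Ad x v)\<close> in \<open>x\<close>
  at the identity.\<close>

lemma Ad_br:
  assumes g: "g \<in> carrier G"
  shows "AD g (br u v) = br (AD g u) (AD g v)"
proof -
  have "((\<lambda>x. AD (pt x) (AD g v)) has_derivative (\<lambda>u. br u (AD g v))) (at (conj_chart g e0))"
    unfolding conj_chart_e0[OF g] by (rule Ad_pt_has_derivative_br)
  with conj_chart_has_derivative[OF g]
  have D: "((\<lambda>x. AD (pt x) (AD g v)) \<circ> conj_chart g has_derivative (\<lambda>u. br u (AD g v)) \<circ> AD g) (at e0)"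
    by (rule diff_chain_at)
  have eq: "((\<lambda>x. AD (pt x) (AD g v)) \<circ> conj_chart g) x = AD g (AD (pt x) v)"
    if "x \<in> \<phi> ` U \<and> g \<otimes>\<^bsub>G\<^esub> pt x \<otimes>\<^bsub>G\<^esub> inv\<^bsub>G\<^esub> g \<in> U" for x
    using that g pt_carrier[of x] by (simp add: conj_chart_def Ad_mult Ad_inv)
  have ev: "\<forall>\<^sub>F x in at e0. ((\<lambda>x. AD (pt x) (AD g v)) \<circ> conj_chart g) x = AD g (AD (pt x) v)"
    using eventually_conj_in_U[OF g] by (rule eventually_mono) (rule eq)
  have "((\<lambda>x. AD g (AD (pt x) v)) has_derivative (\<lambda>u. br u (AD g v)) \<circ> AD g) (at e0)"
    by (rule has_derivative_transform_eventually[OF D ev eq]) (use e0_mem g one_U in simp_all)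
  moreover have "((\<lambda>x. AD g (AD (pt x) v)) has_derivative (\<lambda>u. AD g (br u v))) (at e0)"
    by (rule bounded_linear.has_derivative[OF linear_conv_bounded_linear[THEN iffD1, OF linear_Ad[OF g]]
          Ad_pt_has_derivative_br])
  ultimately have "(\<lambda>u. br u (AD g v)) \<circ> AD g = (\<lambda>u. AD g (br u v))"
    by (rule has_derivative_unique)
  then show ?thesis by (simp add: fun_eq_iff)
qed

text \<open>Differentiate \<open>Ad (x y) v = Ad x (Ad y v)\<close> in \<open>y\<close> at the
  identity.\<close>

lemma Ad_pt_derivative_ltrans:
  assumes x: "x \<in> idom"
  shows "frechet_derivative (\<lambda>x. AD (pt x) v) (at x) (ltrans x N) = AD (pt x) (br N v)"
proof -
  have xU: "x \<in> \<phi> ` U" using x by (rule idom_phi_U)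
  let ?D = "frechet_derivative (\<lambda>x. AD (pt x) v) (at x)"
  have "((\<lambda>x. AD (pt x) v) has_derivative ?D) (at (mu (x, e0)))"
    unfolding mu_e0[OF xU] using Ad_pt_differentiable[OF x] frechet_derivative_works by blast
  with mu_right_has_derivative[OF xU]
  have D: "((\<lambda>x. AD (pt x) v) \<circ> (\<lambda>y. mu (x, y)) has_derivative ?D \<circ> ltrans x) (at e0)"
    by (rule diff_chain_at)
  have eq: "((\<lambda>x. AD (pt x) v) \<circ> (\<lambda>y. mu (x, y))) y = AD (pt x) (AD (pt y) v)" if "(x, y) \<in> mdom" for y
    using that pt_carrier by (simp add: pt_mu Ad_mult mdom_def)
  have "\<forall>\<^sub>F y in at e0. (x, y) \<in> mdom"
    using mu_facts(2) mdom_e0[OF xU] by (intro differentiable_eventually_in_open differentiable_pair) auto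
  then have ev: "\<forall>\<^sub>F y in at e0. ((\<lambda>x. AD (pt x) v) \<circ> (\<lambda>y. mu (x, y))) y = AD (pt x) (AD (pt y) v)"
    by (rule eventually_mono) (rule eq)
  have "((\<lambda>y. AD (pt x) (AD (pt y) v)) has_derivative ?D \<circ> ltrans x) (at e0)"
    by (rule has_derivative_transform_eventually[OF D ev eq[OF mdom_e0[OF xU]]]) simp
  moreover have "((\<lambda>y. AD (pt x) (AD (pt y) v)) has_derivative (\<lambda>u. AD (pt x) (br u v))) (at e0)"
    by (rule bounded_linear.has_derivative[OF linear_conv_bounded_linear[THEN iffD1,
          OF linear_Ad[OF pt_carrier[OF xU]]] Ad_pt_has_derivative_br])
  ultimately have "?D \<circ> ltrans x = (\<lambda>u. AD (pt x) (br u v))"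
    by (rule has_derivative_unique)
  then show ?thesis by (simp add: fun_eq_iff)
qed

text \<open>Along an integral curve \<open>x\<close> of the left-invariant vector field of \<open>N\<close>, the curve
  \<open>Ad (x t)\<close> solves \<open>B' = B \<circ> ad N\<close>, hence acts as the exponential series on vectors
  annihilated by a power of \<open>ad N\<close>.\<close>

lemma exp_in_Ad_image:
  "\<exists>\<epsilon>>0. \<forall>t\<in>{0..\<epsilon>}. \<exists>g\<in>carrier G. \<forall>k Y. (br N ^^ k) Y = 0 \<longrightarrow>
    AD g Y = (\<Sum>i<k. (t ^ i / fact i) *\<^sub>R (br N ^^ i) Y)"
proof -
  \<comment> \<open>The existence theorem needs a continuously differentiable field; the derivative
    of \<open>mu\<close> in the fixed direction \<open>(0, N)\<close> is again smooth.\<close>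
  let ?h = "\<lambda>z. frechet_derivative mu (at z) (0, N)"
  have h: "smooth_on mdom ?h" using mu_facts(1) by (rule smooth_on_frechet_derivative)
  define F' where "F' x v = frechet_derivative ?h (at (x, e0)) (v, 0)" for x v
  have F: "((\<lambda>x. ltrans x N) has_derivative F' x) (at x)" if "x \<in> idom" for x
  proof -
    have "(?h has_derivative frechet_derivative ?h (at (x, e0))) (at (x, e0))"
      using h mdom_e0[OF idom_phi_U[OF that]] by (rule smooth_on_has_derivative)
    moreover have "((\<lambda>x. (x, e0)) has_derivative (\<lambda>v. (v, 0))) (at x)"
      by (auto intro!: derivative_eq_intros)
    ultimately have "(?h \<circ> (\<lambda>x. (x, e0)) has_derivative frechet_derivative ?h (at (x, e0)) \<circ> (\<lambda>v. (v, 0))) (at x)"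
      by (intro diff_chain_at)
    then show ?thesis by (simp add: o_def ltrans_def F'_def[abs_def])
  qed
  have F': "continuous_on idom (\<lambda>x. F' x v)" for v
    unfolding F'_def
    by (rule continuous_on_compose2[OF smooth_on_continuous_on[OF smooth_on_frechet_derivative[OF h]]])
      (auto intro!: continuous_intros mdom_e0 idom_phi_U)
  obtain \<epsilon> x where x: "\<epsilon> > 0" "x 0 = e0" "\<And>t. t \<in> {0..\<epsilon>} \<Longrightarrow> x t \<in> idom"
    "\<And>t. t \<in> {0..\<epsilon>} \<Longrightarrow> (x has_vector_derivative ltrans (x t) N) (at t within {0..\<epsilon>})"
    using picard_lindelof_local[OF iv_facts(2) e0_idom F F'] by blast
  have deriv: "((\<lambda>t. AD (pt (x t)) Y) has_vector_derivative AD (pt (x t)) (br N Y)) (at t within {0..\<epsilon>})"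
    if t: "t \<in> {0..\<epsilon>}" for t Y
  proof -
    let ?D = "frechet_derivative (\<lambda>x. AD (pt x) Y) (at (x t))"
    have "((\<lambda>x. AD (pt x) Y) has_derivative ?D) (at (x t) within x ` {0..\<epsilon>})"
      using Ad_pt_differentiable[OF x(3)[OF t]] frechet_derivative_works has_derivative_at_withinI by blast
    with x(4)[OF t]
    have "((\<lambda>x. AD (pt x) Y) \<circ> x has_vector_derivative ?D (ltrans (x t) N)) (at t within {0..\<epsilon>})"
      by (rule vector_derivative_diff_chain_within)
    then show ?thesis using Ad_pt_derivative_ltrans[OF x(3)[OF t]] by (simp add: o_def)
  qed
  \<comment> \<open>Induction on \<open>k\<close>: the derivative of the left side is the same
    expression for \<open>br N Y\<close>, which one power fewer annihilates, so it equals the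
    derivative of the partial sum. At time 0 both sides are \<open>Y\<close>.\<close>
  have "\<forall>t\<in>{0..\<epsilon>}. AD (pt (x t)) Y = (\<Sum>i<k. (t ^ i / fact i) *\<^sub>R (br N ^^ i) Y)"
    if "(br N ^^ k) Y = 0" for k Y
    using that
  proof (induction k arbitrary: Y)
    case 0
    then show ?case
      using linear_0[OF linear_Ad[OF pt_carrier[OF idom_phi_U[OF x(3)]]]] by simp
  next
    case (Suc k)
    define s where "s t = (\<Sum>i<Suc k. (t ^ i / fact i) *\<^sub>R (br N ^^ i) Y)" for t :: real
    have "(br N ^^ k) (br N Y) = 0" using Suc.prems by (simp add: funpow_swap1)
    note IH = Suc.IH[OF this]
    have s_eq: "s = (\<lambda>t. Y + (\<Sum>i<k. (t ^ Suc i / fact (Suc i)) *\<^sub>R (br N ^^ i) (br N Y)))"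
      by (simp only: s_def fun_eq_iff sum.lessThan_Suc_shift) (simp add: funpow_swap1)
    have pw: "((\<lambda>t. t ^ Suc i / fact (Suc i)) has_real_derivative t ^ i / fact i) (at t within {0..\<epsilon>})" for i t
    proof -
      have "((\<lambda>t. t ^ Suc i / fact (Suc i)) has_real_derivative real (Suc i) * t ^ i / fact (Suc i)) (at t within {0..\<epsilon>})"
        by (rule DERIV_cdivide) (auto intro!: derivative_eq_intros simp del: power_Suc)
      moreover have "real (Suc i) * t ^ i / fact (Suc i) = t ^ i / fact i" by simp
      ultimately show ?thesis by metis
    qed
    have pwv: "((\<lambda>t. (t ^ Suc i / fact (Suc i)) *\<^sub>R v) has_vector_derivative (t ^ i / fact i) *\<^sub>R v)
        (at t within {0..\<epsilon>})" for i t and v :: "real^'n"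
      using has_vector_derivative_scaleR[OF pw has_vector_derivative_const] by (simp del: power_Suc fact_Suc)
    have "(s has_vector_derivative 0 + (\<Sum>i<k. (t ^ i / fact i) *\<^sub>R (br N ^^ i) (br N Y))) (at t within {0..\<epsilon>})" for t
      unfolding s_eq
      by (intro has_vector_derivative_add has_vector_derivative_const has_vector_derivative_sum pwv)
    note s_deriv = this
    have "((\<lambda>t. AD (pt (x t)) Y - s t) has_vector_derivative 0) (at t within {0..\<epsilon>})" if t: "t \<in> {0..\<epsilon>}" for t
      using has_vector_derivative_diff[OF deriv[OF t, of Y] s_deriv[of t]] IH[rule_format, OF t] by simp
    then obtain c where c: "\<And>t. t \<in> {0..\<epsilon>} \<Longrightarrow> AD (pt (x t)) Y - s t = c"
      using has_vector_derivative_zero_constant[of "{0..\<epsilon>}" "\<lambda>t. AD (pt (x t)) Y - s t"] by auto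
    have "c = 0" using c[of 0] x(1,2) by (simp add: Ad_one s_eq)
    then show ?case using c by (auto simp: s_def simp del: sum.lessThan_Suc)
  qed
  note series = this
  have "pt (x t) \<in> carrier G" if "t \<in> {0..\<epsilon>}" for t
    using pt_carrier[OF idom_phi_U[OF x(3)[OF that]]] .
  then have "\<forall>t\<in>{0..\<epsilon>}. \<exists>g\<in>carrier G. \<forall>k Y. (br N ^^ k) Y = 0 \<longrightarrow>
      AD g Y = (\<Sum>i<k. (t ^ i / fact i) *\<^sub>R (br N ^^ i) Y)"
    using series by (intro ballI bexI[of _ "pt (x _)"] allI impI) auto
  then show ?thesis using x(1) by blast
qed

end

section \<open>The ruling of a regular orbit\<close>

text \<open>\<open>V\<close> is determined by its tangent vector only up to the stabilizer of
  \<open>X\<close>. Replacing it by \<open>V'\<close> in \<open>n\<close> with the same tangent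
  vector does not change \<open>B([U, X], V)\<close>, which is minus the form, and
  \<open>B([U, X], V')\<close> vanishes because both entries lie in \<open>n\<close>.\<close>

lemma (in real_lie_algebra) kirillov_form_eq_0:
  assumes n: "\<And>x y. x \<in> n \<Longrightarrow> y \<in> n \<Longrightarrow> killing br x y = 0" "(\<lambda>U. br U X) ` n = n"
    and U: "br U X \<in> n" and V: "br V X \<in> n" and "subspace n"
  shows "kirillov_form br X U V = 0"
proof -
  obtain V' where V': "V' \<in> n" "br V X = br V' X" using V n(2) by (metis imageE)
  have 0: "br X (V - V') = 0" using V'(2) br_eq_0_commute[of X "V - V'"] by (simp add: br_simps)
  then have "killing br (br U X) (V - V') = 0"
    unfolding killing_invariant 0 by (simp add: killing_simps)
  moreover have "killing br (br U X) V' = 0" using n(1) U V'(1) by blast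
  ultimately have "killing br (br U X) V = 0" by (simp add: killing_simps)
  then show ?thesis
    using killing_invariant[of X U V] br_skew[of X U] by (simp add: kirillov_form_def killing_simps)
qed

theorem theorem4p1:
  fixes G :: "('g, 'b) monoid_scheme"
    and T :: "'g topology"
    and A :: "('g, 'n::finite) gchart set"
    and c :: "('g, 'n) gchart"
    and br :: "'n bracket"
    and \<theta> :: "real^'n \<Rightarrow> real^'n"
    and h0 a :: "(real^'n) set"
    and \<Delta>p :: "(real^'n \<Rightarrow> complex) set"
    and \<Sigma>p :: "(real^'n \<Rightarrow> real) set"
    and j :: nat
    and \<alpha> :: "nat \<Rightarrow> real^'n \<Rightarrow> complex"
    and E :: "nat \<Rightarrow> real^'n"
    and \<Sigma> :: "nat \<Rightarrow> (real^'n \<Rightarrow> real) set"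
    and \<Omega> n_j :: "(real^'n) set"
    and X :: "real^'n"
    and \<L> :: "(real^'n) set set"
    and D :: "real^'n \<Rightarrow> (real^'n) set"
  assumes "lie_group G T A" and "connected_space T"
    and "c \<in> A" and "\<one>\<^bsub>G\<^esub> \<in> fst c" and "br = lie_bracket G c"
    and "simple_lie_algebra br" and "noncompact_lie_algebra br"
    and "cartan_involution br \<theta>"
    and "maximally_noncompact_cartan br \<theta> h0" and "a = h0 \<inter> p_part \<theta>"
    and "positive_system (roots br h0) \<Delta>p"
    and "positive_system (restricted_roots br a) \<Sigma>p"
    and "compatible_positive a \<Delta>p \<Sigma>p"
    and "admissible_system br h0 \<Delta>p j \<alpha>"
    and "\<forall>m\<in>{1..j}. normalized_root_vector br \<theta> h0 (\<alpha> m) (E m)"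
    and "regular_orbit G c br \<Omega>"
    and "orbit_of_type G c br (cayley_cartan \<theta> h0 j \<alpha> E) \<Omega>"
    and "X \<in> \<Omega>" and "stabilizer_algebra br X = cayley_cartan \<theta> h0 j \<alpha> E"
    and "nilpotent_chain (restricted_roots br a) \<Sigma>p j (\<lambda>m. restrict_root a (\<alpha> m)) \<Sigma>"
    and "n_j = nilpotent_subalgebra br a (\<Sigma> j)"
    and "foliation \<Omega> \<L> D" and "left_invariant G c \<Omega> D"
    and "D X = (\<lambda>U. br U X) ` n_j"
  shows "isotropic_distribution br \<Omega> D \<and> affine_ruling (dim n_j) \<L>"
proof -
  obtain U \<phi> where c: "c = (U, \<phi>)" by (cases c)
  interpret lg: lie_group_chart G T A U \<phi>
    using assms(1,3,4) unfolding c by unfold_locales auto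
  have br: "br = lie_bracket G (U, \<phi>)" using assms(5) by (simp add: c)
  interpret L: cartan_lie_algebra br \<theta>
    using assms(6,8) by unfold_locales (auto simp: simple_lie_algebra_def)
  let ?AD = "Ad G c" and ?\<beta> = "\<lambda>m. restrict_root a (\<alpha> m)"
  note linear_Ad = lg.linear_Ad[folded c] and bij_Ad = lg.bij_Ad[folded c]
    and Ad_mult = lg.Ad_mult[folded c] and Ad_br = lg.Ad_br[folded br c] and Ad_inv = lg.Ad_inv[folded c]
  have h0: "stable_cartan br \<theta> h0"
    using assms(9) by (simp add: maximally_noncompact_cartan_def)
  have a_p: "a \<subseteq> p_part \<theta>" using assms(10) by blast
  obtain l where l: "nilpotent_root_set br \<theta> a (\<Sigma> j) l" "\<And>\<mu>. \<mu> \<in> \<Sigma>p \<Longrightarrow> l \<mu> > 0"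
    and cond: "nilpotent_conditions (restricted_roots br a) ?\<beta> j (\<Sigma> j)"
    using L.nilpotent_chain_nilpotent_root_set[OF a_p assms(12) assms(20)] by blast
  interpret N: nilpotent_root_set br \<theta> a "\<Sigma> j" l by (rule l(1))
  define n where "n = n_j"
  have n_eq: "nilpotent_subalgebra br a (\<Sigma> j) = n" using assms(21) by (simp add: n_def)
  have pos: "l (?\<beta> m) > 0" if "m \<in> {1..j}" "?\<beta> m \<noteq> 0" for m
    using that assms(13,14) l(2) by (auto simp: compatible_positive_def admissible_system_def)
  have cond': "\<And>m. m \<in> {1..j} \<Longrightarrow> ?\<beta> m \<notin> \<Sigma> j"
    "\<And>m \<mu>. m \<in> {1..j} \<Longrightarrow> \<mu> \<in> \<Sigma> j \<Longrightarrow> \<mu> + ?\<beta> m \<in> restricted_roots br a \<Longrightarrow> \<mu> + ?\<beta> m \<in> \<Sigma> j"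
    "\<And>m \<mu>. m \<in> {1..j} \<Longrightarrow> \<mu> \<in> \<Sigma> j \<Longrightarrow> \<mu> - ?\<beta> m \<in> restricted_roots br a \<Longrightarrow> \<mu> - ?\<beta> m \<in> \<Sigma> j"
    using cond unfolding nilpotent_conditions_def by blast+
  have hF: "br z x \<in> n" if "z \<in> cayley_cartan \<theta> h0 j \<alpha> E" "x \<in> n" for x z
    unfolding n_eq[symmetric]
    by (rule N.cayley_cartan_nil(1)[OF h0 assms(10,14,15) refl _ _ _ _ that(1)])
      (assumption | rule pos cond' that(2)[folded n_eq])+
  have hF0: "z = 0" if "z \<in> cayley_cartan \<theta> h0 j \<alpha> E" "z \<in> n" for z
    by (rule N.cayley_cartan_nil(2)[OF h0 assms(10,14,15) refl _ _ _ _ that(1)])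
      (assumption | rule pos cond' that(2)[folded n_eq])+
  note sub = N.subspace_nil[unfolded n_eq] and closed = N.br_nil[unfolded n_eq]
    and killing_n = N.killing_nil[unfolded n_eq]
  obtain K where K: "lower_central br n K = {0}" using N.lower_central_nil[unfolded n_eq] by blast
  have stab: "z \<in> cayley_cartan \<theta> h0 j \<alpha> E" if "br X z = 0" for z
    using that unfolding assms(19)[symmetric] stabilizer_algebra_def by (rule CollectI)
  note X_norm = hF[OF stab[OF L.br_self]]
  have X_inj: "x = 0" if "x \<in> n" "br X x = 0" for x
    using stab[OF that(2)] that(1) by (rule hF0)
  have "br X ` n = n" using L.br_image_eq[OF sub X_norm X_inj] by blast
  moreover have "(\<lambda>U. br U X) ` n = br X ` n"
  proof -
    have "(\<lambda>U. br U X) ` n = br X ` uminus ` n"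
      unfolding image_image using L.br_skew[of _ X] by (simp add: L.br_simps)
    also have "uminus ` n = n"
      using sub subspace_neg by (force simp: image_iff intro: bexI[of _ "- _"])
    finally show ?thesis .
  qed
  ultimately have adX: "(\<lambda>U. br U X) ` n = n" by simp
  have DX: "D X = n" using assms(24) adX by (simp add: n_def)
  have trans: "\<exists>g\<in>carrier G. ?AD g X = X + w \<and> ?AD g ` n = n" if "w \<in> n" for w
  proof -
    have "\<exists>B\<in>?AD ` carrier G. B X = X + w \<and> B ` n \<subseteq> n"
    proof (rule L.unipotent_transitive[OF sub closed K X_norm X_inj _ _ _ that])
      show "id \<in> ?AD ` carrier G"
        using lg.Ad_one[folded c] by (metis image_eqI lg.one_closed)
      show "B \<circ> C \<in> ?AD ` carrier G" if BC: "B \<in> ?AD ` carrier G" "C \<in> ?AD ` carrier G" for B C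
      proof -
        obtain g h where gh: "g \<in> carrier G" "B = ?AD g" "h \<in> carrier G" "C = ?AD h" using BC by blast
        then have "B \<circ> C = ?AD (g \<otimes>\<^bsub>G\<^esub> h)" by (simp add: Ad_mult)
        then show ?thesis using gh by blast
      qed
      fix U assume "U \<in> n"
      obtain \<epsilon> where \<epsilon>: "\<epsilon> > 0" "\<And>t. t \<in> {0..\<epsilon>} \<Longrightarrow> \<exists>g\<in>carrier G. \<forall>k Y. (br U ^^ k) Y = 0 \<longrightarrow>
          ?AD g Y = (\<Sum>i<k. (t ^ i / fact i) *\<^sub>R (br U ^^ i) Y)"
        using lg.exp_in_Ad_image[folded br c] by blast
      \<comment> \<open>Times up to \<open>\<epsilon>\<close> are available; a large
        \<open>p\<close> brings \<open>1 / p\<close> among them.\<close>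
      obtain p :: nat where p: "p > 0" "1 / real p < \<epsilon>"
        using \<epsilon>(1) by (metis nat_approx_posE of_nat_Suc zero_less_Suc)
      then show "\<exists>B\<in>?AD ` carrier G. \<exists>p::nat. p > 0 \<and> (\<forall>Y k. (br U ^^ k) Y = 0 \<longrightarrow>
          B Y = (\<Sum>i<k. ((1 / real p) ^ i / fact i) *\<^sub>R (br U ^^ i) Y))"
        using \<epsilon>(2)[of "1 / real p"] by auto
    qed auto
    then obtain g where g: "g \<in> carrier G" "?AD g X = X + w" "?AD g ` n \<subseteq> n" by blast
    \<comment> \<open>Equal dimensions turn the inclusion into an equality, needed for
      \<open>D\<close> to be the same subspace at the moved point.\<close>
    have "dim (?AD g ` n) = dim n"
      using linear_Ad[OF g(1)] bij_Ad[OF g(1)] by (intro dim_image_eq) (auto intro: inj_on_subset bij_is_inj)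
    then have "?AD g ` n = n"
      using g(3) sub linear_subspace_image[OF linear_Ad[OF g(1)] sub] by (intro subspace_dim_equal) auto
    then show ?thesis using g by blast
  qed
  \<comment> \<open>The orbit is presented through a regular \<open>Z\<close>; it is re-based at
    \<open>X\<close>, where the stabilizer and \<open>D\<close> are known.\<close>
  obtain Z where Z: "\<Omega> = adjoint_orbit G c Z" using assms(16) by (auto simp: regular_orbit_def)
  obtain g0 where g0: "g0 \<in> carrier G" "X = ?AD g0 Z"
    using assms(18) by (auto simp: Z adjoint_orbit_def)
  have orbit: "?AD g X \<in> \<Omega>" if "g \<in> carrier G" for g
    using that g0 Ad_mult[of g g0] by (auto simp: Z adjoint_orbit_def intro!: exI[of _ "g \<otimes>\<^bsub>G\<^esub> g0"])
  have orbitE: "\<exists>g\<in>carrier G. Y = ?AD g X" if Y: "Y \<in> \<Omega>" for Y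
  proof -
    obtain g where g: "g \<in> carrier G" "Y = ?AD g Z" using Y by (auto simp: Z adjoint_orbit_def)
    then have "Y = ?AD (g \<otimes>\<^bsub>G\<^esub> inv\<^bsub>G\<^esub> g0) X" using g0 Ad_mult Ad_inv by simp
    then show ?thesis using g g0 by blast
  qed
  have inv_D: "D (?AD g Y) = ?AD g ` D Y" if "g \<in> carrier G" "Y \<in> \<Omega>" for g Y
    using assms(23) that by (auto simp: left_invariant_def)
  have "isotropic_distribution br \<Omega> D"
    unfolding isotropic_distribution_def
  proof (intro ballI allI impI)
    fix Y U V assume Y: "Y \<in> \<Omega>" and U: "br U Y \<in> D Y" and V: "br V Y \<in> D Y"
    obtain g where g: "g \<in> carrier G" "Y = ?AD g X" using orbitE[OF Y] by blast
    have DY: "D Y = ?AD g ` n" using inv_D[OF g(1) assms(18)] g DX by simp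
    have pull: "br (?AD (inv\<^bsub>G\<^esub> g) W) X \<in> n" if "br W Y \<in> D Y" for W
    proof -
      have "?AD g (br (?AD (inv\<^bsub>G\<^esub> g) W) X) = br W Y"
        using g by (simp add: Ad_br Ad_inv)
      then have "?AD g (br (?AD (inv\<^bsub>G\<^esub> g) W) X) \<in> ?AD g ` n" using that by (simp add: DY)
      then show ?thesis
        using inj_image_mem_iff[OF bij_is_inj[OF bij_Ad[OF g(1)]]] by blast
    qed
    \<comment> \<open>Invariance of bracket and Killing form under \<open>Ad g\<close> moves the
      computation to the base point \<open>X\<close>.\<close>
    have "kirillov_form br Y U V =
        killing br (?AD g X) (?AD g (br (?AD (inv\<^bsub>G\<^esub> g) U) (?AD (inv\<^bsub>G\<^esub> g) V)))"
      using g by (simp add: kirillov_form_def Ad_br Ad_inv)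
    also have "\<dots> = kirillov_form br X (?AD (inv\<^bsub>G\<^esub> g) U) (?AD (inv\<^bsub>G\<^esub> g) V)"
      unfolding kirillov_form_def
      using linear_Ad bij_Ad Ad_br g(1) by (intro L.killing_automorphism) blast+
    also have "\<dots> = 0"
      using killing_n adX pull[OF U] pull[OF V] sub by (rule L.kirillov_form_eq_0)
    finally show "kirillov_form br Y U V = 0" .
  qed
  moreover have "affine_ruling (dim n) \<L>"
  proof (rule foliation_affine_ruling[OF assms(22)])
    fix Y assume "Y \<in> \<Omega>"
    then obtain g where g: "g \<in> carrier G" "Y = ?AD g X" using orbitE by blast
    let ?W = "?AD g ` n"
    have lin: "linear (?AD g)" using linear_Ad g(1) by blast
    have "subspace ?W" using lin sub by (rule linear_subspace_image)
    moreover have "dim ?W = dim n"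
      using lin bij_Ad[OF g(1)] by (intro dim_image_eq) (auto intro: inj_on_subset bij_is_inj)
    \<comment> \<open>The point \<open>Y + Ad g w\<close> is \<open>Ad g (Ad h X)\<close> with
      \<open>Ad h\<close> preserving \<open>n\<close>, so invariance of \<open>D\<close> returns the
      same direction space.\<close>
    moreover have "y \<in> \<Omega> \<and> D y = ?W" if "y \<in> (+) Y ` ?W" for y
    proof -
      obtain w where w: "w \<in> n" "y = Y + ?AD g w" using \<open>y \<in> (+) Y ` ?W\<close> by blast
      obtain h where h: "h \<in> carrier G" "?AD h X = X + w" "?AD h ` n = n" using trans[OF w(1)] by blast
      have y: "y = ?AD g (?AD h X)" using w g h lin by (simp add: linear_add)
      then have "y = ?AD (g \<otimes>\<^bsub>G\<^esub> h) X" using Ad_mult g h by simp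
      then have "y \<in> \<Omega>" using orbit g h by simp
      moreover have "D y = ?W"
        unfolding y using inv_D[OF g(1) orbit[OF h(1)]] inv_D[OF h(1) assms(18)] h(3) DX by simp
      ultimately show ?thesis by blast
    qed
    ultimately show "\<exists>W. subspace W \<and> dim W = dim n \<and> (+) Y ` W \<subseteq> \<Omega> \<and> (\<forall>x\<in>(+) Y ` W. D x = W)"
      by blast
  qed
  ultimately show ?thesis by (simp add: n_def)
qed

end
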